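(* The following hold, where $A[v]$ denotes $A[a,b,c]$ for $v=(a,b,c)$. (i) Let $v_1=(1,1,1)$. Then $\mathbb V_1[A[v_1]]=\mathbb V_1\cap\mathbb T[A[v_1]]$. (ii) For every real number $b>0$ with $b\neq 1$, with $v_b=(2,b,\frac1b)$, we have $\mathbb V_1[A[v_b]]=\Phi(\tfrac1b)'\cap\mathbb T[A[v_b]]$. (iii) For every real number $b>0$ with $b\neq 1$, and for every point $e_b=(1-s)v_1+s v_b$ with $0<s<1$ (i.e. any interior point of the line segment between $v_1=(1,1,1)$ and $v_b=(2,b,\frac1b)$), the face $\mathbb V_1[A[e_b]]$ equals $\Phi(\tfrac1b)'$, and this face is the convex hull of $\mathbb V_1[A[v_1]]\cup\mathbb V_1[A[v_b]]$.
   Context: $M_n$ is the algebra of complex $n\times n$ matrices, with matrix units $e_{ij}$. Everything takes place in $M_3\otimes M_3$, identified with $9\times 9$ matrices using the lexicographically ordered basis $e_i\otimes e_j$ of $\mathbb C^3\otimes\mathbb C^3$. $\mathbb V_1$ is the convex cone generated by the separable states, i.e. all finite sums of matrices $zz^*$ with $z=x\otimes y$ a product vector in $\mathbb C^3\otimes\mathbb C^3$. For $A=\sum e_{ij}\otimes x_{ij}$ the partial transpose is $A^\Gamma=\sum e_{ij}\otimes x_{ji}$. $\mathbb T$ is the convex cone of all positive semi-definite $A$ with $A^\Gamma$ positive semi-definite; $\mathbb V_1\subset\mathbb T$. A convex subset $F$ of a convex set $C$ is a face of $C$ if $x,y\in C$ and $(1-t)x+ty\in F$ for some $t\in(0,1)$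 imply $x,y\in F$. For $A\in\mathbb V_1$, $\mathbb V_1[A]$ is the smallest face of $\mathbb V_1$ containing $A$. With $\mathcal R$ denoting range, $\mathbb T[A]=\{B\in\mathbb T:\mathcal RB\subset\mathcal RA,\ \mathcal RB^\Gamma\subset\mathcal RA^\Gamma\}$, which is the smallest face of $\mathbb T$ containing $A$. For nonnegative reals $a,b,c$, $A[a,b,c]$ is the $9\times9$ matrix with diagonal $(a,c,b,b,a,c,c,b,a)$, with entry $1$ at the positions $(i,j)$ for $i\ne j$ in $\{1,5,9\}$, and all other entries $0$. For nonnegative reals $\alpha,\beta,\gamma$, the linear map $\Phi[\alpha,\beta,\gamma]:M_3\to M_3$ is $$\Phi[\alpha,\beta,\gamma](X)=\begin{pmatrix}\alpha x_{11}+\beta x_{22}+\gamma x_{33}&-x_{12}&-x_{13}\\-x_{21}&\gamma x_{11}+\alpha x_{22}+\beta x_{33}&-x_{23}\\-x_{31}&-x_{32}&\beta x_{11}+\gamma x_{22}+\alpha x_{33}\end{pmatrix},$$ and for $0<t<\infty$, $\Phi(t)=\Phi\left[\frac{(1-t)^2}{1-t+t^2},\frac{t^2}{1-t+t^2},\frac{1}{1-t+t^2}\right]$, which is a positive linear map. For a linear map $\phi:M_3\to M_3$ and $A\in M_3\otimes M_3$, $\langle A,\phi\rangle=\mathrm{Tr}(C_\phi A^{\mathrm t})$ with $C_\phi=\sum_{i,j}e_{ij}\otimes\phi(e_{ij})$ and $A^{\mathrm t}$ the full transpose. For a positive linear map $\phi$, its dual face is $\phi'=\{A\in\mathbb V_1:\langle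 A,\phi\rangle=0\}$, a face of $\mathbb V_1$. *)

theory Defs
  imports "HOL-Analysis.Analysis"
begin

text \<open>
  Elements of \<open>M\<^sub>3 \<otimes> M\<^sub>3\<close> are matrices indexed by pairs in \<open>3 \<times> 3\<close>: the index \<open>(i, k)\<close> stands
  for the basis vector \<open>e\<^sub>i \<otimes> e\<^sub>k\<close>, which has position \<open>3 (i - 1) + k\<close> in the lexicographic order.
  In the type \<open>3\<close> the indices are \<open>1\<close>, \<open>2\<close>, \<open>3\<close> (with \<open>3 = 0\<close>).
\<close>

type_synonym M3 = "complex ^ 3 ^ 3"
type_synonym M33 = "complex ^ (3 \<times> 3) ^ (3 \<times> 3)"

definition tensor_vec :: "complex ^ 3 \<Rightarrow> complex ^ 3 \<Rightarrow> complex ^ (3 \<times> 3)" where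
  "tensor_vec x y = (\<chi> p. x $ fst p * y $ snd p)"

definition tensor_mat :: "M3 \<Rightarrow> M3 \<Rightarrow> M33" where
  "tensor_mat X Y = (\<chi> p q. X $ fst p $ fst q * Y $ snd p $ snd q)"

definition mat_unit :: "3 \<Rightarrow> 3 \<Rightarrow> M3" where
  "mat_unit i j = (\<chi> k l. if k = i \<and> l = j then 1 else 0)"

text \<open>\<open>z z\<^sup>*\<close>\<close>

definition rank_one :: "complex ^ 'n \<Rightarrow> complex ^ 'n ^ 'n" where
  "rank_one z = (\<chi> p q. z $ p * cnj (z $ q))"

definition pos_semidef :: "complex ^ 'n ^ 'n \<Rightarrow> bool" where
  "pos_semidef A \<longleftrightarrow>
     (\<forall>p q. A $ q $ p = cnj (A $ p $ q)) \<and>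
     (\<forall>x. 0 \<le> Re (\<Sum>p\<in>UNIV. cnj (x $ p) * (A *v x) $ p))"

definition mat_range :: "complex ^ 'n ^ 'm \<Rightarrow> (complex ^ 'm) set" where
  "mat_range A = range (\<lambda>x. A *v x)"

text \<open>The blocks \<open>x\<^sub>i\<^sub>j\<close> are swapped, not transposed: the first tensor factor is transposed.\<close>

definition partial_transpose :: "M33 \<Rightarrow> M33" where
  "partial_transpose A = (\<chi> p q. A $ (fst q, snd p) $ (fst p, snd q))"

definition V1 :: "M33 set" where
  "V1 = {\<Sum>k<n. rank_one (tensor_vec (x k) (y k)) | (n :: nat) x y. True}"

definition PPT :: "M33 set" where
  "PPT = {A. pos_semidef A \<and> pos_semidef (partial_transpose A)}"

text \<open>The smallest face of \<open>V1\<close> containing \<open>A\<close>, as the intersection of all such faces;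
  meaningful for \<open>A \<in> V1\<close> (otherwise the intersection is over the empty family, hence \<open>UNIV\<close>).\<close>

definition V1_face :: "M33 \<Rightarrow> M33 set" where
  "V1_face A = (\<lambda>F. F face_of V1) hull {A}"

definition PPT_face :: "M33 \<Rightarrow> M33 set" where
  "PPT_face A = {B \<in> PPT. mat_range B \<subseteq> mat_range A \<and>
     mat_range (partial_transpose B) \<subseteq> mat_range (partial_transpose A)}"

text \<open>The rows of the \<open>3 \<times> 3\<close> array below, read one after the other, are the diagonal
  \<open>(a, c, b, b, a, c, c, b, a)\<close>; positions 1, 5, 9 are the index pairs \<open>(i, i)\<close>.\<close>

fun A_mat :: "real \<times> real \<times> real \<Rightarrow> M33" where
  "A_mat (a, b, c) = (\<chi> p q.
     if p = q then
       of_real ((vector [vector [a, c, b],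
                         vector [b, a, c],
                         vector [c, b, a]] :: real ^ 3 ^ 3) $ fst p $ snd p)
     else if fst p = snd p \<and> fst q = snd q then 1
     else 0)"

definition Phi_abc :: "real \<Rightarrow> real \<Rightarrow> real \<Rightarrow> M3 \<Rightarrow> M3" where
  "Phi_abc \<alpha> \<beta> \<gamma> X = vector
    [vector [of_real \<alpha> * X$1$1 + of_real \<beta> * X$2$2 + of_real \<gamma> * X$3$3, - X$1$2, - X$1$3],
     vector [- X$2$1, of_real \<gamma> * X$1$1 + of_real \<alpha> * X$2$2 + of_real \<beta> * X$3$3, - X$2$3],
     vector [- X$3$1, - X$3$2, of_real \<beta> * X$1$1 + of_real \<gamma> * X$2$2 + of_real \<alpha> * X$3$3]]"

definition Phi :: "real \<Rightarrow> M3 \<Rightarrow> M3" where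
  "Phi t = Phi_abc ((1 - t)\<^sup>2 / (1 - t + t\<^sup>2)) (t\<^sup>2 / (1 - t + t\<^sup>2)) (1 / (1 - t + t\<^sup>2))"

definition choi_matrix :: "(M3 \<Rightarrow> M3) \<Rightarrow> M33" where
  "choi_matrix \<phi> = (\<Sum>i\<in>UNIV. \<Sum>j\<in>UNIV. tensor_mat (mat_unit i j) (\<phi> (mat_unit i j)))"

definition pairing :: "M33 \<Rightarrow> (M3 \<Rightarrow> M3) \<Rightarrow> complex" where
  "pairing A \<phi> = trace (choi_matrix \<phi> ** transpose A)"

definition dual_face :: "(M3 \<Rightarrow> M3) \<Rightarrow> M33 set" where
  "dual_face \<phi> = {A \<in> V1. pairing A \<phi> = 0}"

end

theory Submission imports Defs
begin

text \<open>
  Write \<open>t = 1 / b\<close>. A product vector \<open>x \<otimes> y\<close> is annihilated by \<open>\<Phi>(t)\<close> precisely if it is, up to a scalar,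
  either circular (all \<open>x\<^sub>i\<close> of equal modulus, all \<open>x\<^sub>i y\<^sub>i\<close> equal) or supported on two cyclically
  consecutive levels \<open>i, j\<close> with \<open>x\<^sub>i y\<^sub>i = x\<^sub>j y\<^sub>j\<close> and \<open>|x\<^sub>i|\<^sup>2 = t |x\<^sub>j|\<^sup>2\<close>. Indeed the determinant of
  \<open>\<Phi>(t)(xx\<^sup>*)\<close> is up to a positive factor a cyclic cubic in \<open>|x\<^sub>1|\<^sup>2 = p\<close>, \<open>p + u\<close>, \<open>p + v\<close>; if \<open>p\<close> is the
  smallest of the three, this cubic is the visibly nonnegative expression
  \<open>p (1 - t + t\<^sup>2)\<^sup>2 (u\<^sup>2 - u v + v\<^sup>2) + (t\<^sup>2 u + v) (u - t v)\<^sup>2\<close>.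

  Averaging a circular vector over diagonal unitaries gives a multiple of \<open>A[1,1,1]\<close>; averaging the three
  types of two-level vectors gives summands of \<open>A[2,b,1/b]\<close>. Hence these vectors lie in the corresponding
  faces. Conversely, all conditions on the right-hand sides are zero sets of functionals that are nonnegative
  on separable states (the range conditions become such functionals on the cone \<open>V1\<close>), so they cut out
  faces. The range conditions single out the circular vectors for \<open>A[1,1,1]\<close> and exclude them
  for \<open>A[2,b,1/b]\<close>.
\<close>

subsection \<open>The quadratic form of \<open>\<Phi>(t)\<close> on moduli\<close>

text \<open>
  The value of \<open>(1 - t + t\<^sup>2) \<langle>zz\<^sup>*, \<Phi>(t)\<rangle>\<close> at \<open>z = x \<otimes> y\<close> when all phases are aligned, in terms of
  \<open>X\<^sub>i = |x\<^sub>i|\<close> and \<open>Y\<^sub>i = |y\<^sub>i|\<close>.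
\<close>

definition choi_form where
  "choi_form (t::real) X1 X2 X3 Y1 Y2 Y3 =
     Y1\<^sup>2 * ((1 - t)\<^sup>2 * X1\<^sup>2 + t\<^sup>2 * X2\<^sup>2 + X3\<^sup>2)
   + Y2\<^sup>2 * (X1\<^sup>2 + (1 - t)\<^sup>2 * X2\<^sup>2 + t\<^sup>2 * X3\<^sup>2)
   + Y3\<^sup>2 * (t\<^sup>2 * X1\<^sup>2 + X2\<^sup>2 + (1 - t)\<^sup>2 * X3\<^sup>2)
   - 2 * (1 - t + t\<^sup>2) * (X1 * X2 * Y1 * Y2 + X2 * X3 * Y2 * Y3 + X3 * X1 * Y3 * Y1)"

lemma choi_form_cyclic: "choi_form t X2 X3 X1 Y2 Y3 Y1 = choi_form t X1 X2 X3 Y1 Y2 Y3"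
  unfolding choi_form_def by algebra

lemma one_minus_plus_square_pos: "0 < 1 - t + (t::real)\<^sup>2"
proof -
  have "1 - t + t\<^sup>2 = (t - 1/2)\<^sup>2 + 3/4"
    by (simp add: power2_eq_square algebra_simps)
  then show ?thesis
    using zero_le_power2[of "t - 1/2"] by linarith
qed

text \<open>The determinant of the quadratic form \<open>choi_form\<close> in \<open>Y\<close>, where \<open>p, q, r\<close> are the squares of the \<open>X\<^sub>i\<close>.\<close>

definition choi_det where
  "choi_det (t::real) p q r =
     ((1 - t)\<^sup>2 * p + t\<^sup>2 * q + r) * (p + (1 - t)\<^sup>2 * q + t\<^sup>2 * r) * (t\<^sup>2 * p + q + (1 - t)\<^sup>2 * r)
   - (1 - t + t\<^sup>2)\<^sup>2 * (((1 - t)\<^sup>2 * p + t\<^sup>2 * q + r) * q * r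
       + (p + (1 - t)\<^sup>2 * q + t\<^sup>2 * r) * p * r + (t\<^sup>2 * p + q + (1 - t)\<^sup>2 * r) * p * q)
   - 2 * (1 - t + t\<^sup>2)^3 * (p * q * r)"

lemma choi_det_cyclic: "choi_det t q r p = choi_det t p q r"
  unfolding choi_det_def by (simp only: ac_simps)

text \<open>The three diagonal entries of the form become \<open>2 * D * p\<close> plus
  \<open>a\<close>, \<open>b\<close>, \<open>c\<close>. Since
  \<open>a + b + c = 2 * D * (u + v)\<close>, the cubic and quadratic terms in \<open>p\<close>
  cancel, so the determinant is affine in \<open>p\<close> and its two coefficients are factored
  separately.\<close>

lemma choi_det_shift:
  "choi_det t p (p + u) (p + v) =
     (1 - t)\<^sup>2 * (p * (1 - t + t\<^sup>2)\<^sup>2 * (u\<^sup>2 - u * v + v\<^sup>2) + (t\<^sup>2 * u + v) * (u - t * v)\<^sup>2)"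
proof -
  define s D where "s = (1 - t)\<^sup>2" and "D = 1 - t + t\<^sup>2"
  define a b c where "a = t\<^sup>2 * u + v" and "b = s * u + t\<^sup>2 * v" and "c = u + s * v"
  have sD: "s + t\<^sup>2 + 1 = 2 * D" "D = s + t"
    unfolding s_def D_def by algebra+
  have ABC: "s * p + t\<^sup>2 * (p + u) + (p + v) = 2 * D * p + a"
    "p + s * (p + u) + t\<^sup>2 * (p + v) = 2 * D * p + b"
    "t\<^sup>2 * p + (p + u) + s * (p + v) = 2 * D * p + c"
    unfolding a_def b_def c_def using sD(1) by algebra+
  have abc: "a + b + c = 2 * D * (u + v)"
    unfolding a_def b_def c_def using sD(1) by algebra
  have "choi_det t p (p + u) (p + v) =
      p * (2 * D * (a * b + b * c + c * a) - 4 * D ^ 3 * u * v - D\<^sup>2 * (a * (u + v) + b * v + c * u))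
      + a * (b * c - D\<^sup>2 * u * v)"
    unfolding choi_det_def s_def[symmetric] D_def[symmetric] ABC using abc by algebra
  moreover have "b * c - D\<^sup>2 * u * v = s * (u - t * v)\<^sup>2"
    unfolding b_def c_def using sD by algebra
  moreover have "2 * D * (a * b + b * c + c * a) - 4 * D ^ 3 * u * v - D\<^sup>2 * (a * (u + v) + b * v + c * u)
      = s * D\<^sup>2 * (u\<^sup>2 - u * v + v\<^sup>2)"
    unfolding a_def b_def c_def using sD by algebra
  ultimately show ?thesis
    unfolding s_def[symmetric] D_def[symmetric] a_def by algebra
qed

lemma choi_det_pos_min:
  assumes "t > 0" "t \<noteq> 1" "p > 0" "p \<le> q" "p \<le> r" "\<not> (p = q \<and> q = r)"
  shows "choi_det t p q r > 0"
proof -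
  define u v where "u = q - p" and "v = r - p"
  have uv: "q = p + u" "r = p + v" "u \<ge> 0" "v \<ge> 0" "u \<noteq> 0 \<or> v \<noteq> 0"
    using assms unfolding u_def v_def by auto
  have "u\<^sup>2 - u * v + v\<^sup>2 = ((u - v)\<^sup>2 + u\<^sup>2 + v\<^sup>2) / 2"
    by (simp add: power2_eq_square algebra_simps)
  also have "\<dots> > 0"
    using uv(5) zero_le_power2[of "u - v"] zero_less_power2[of u] zero_less_power2[of v]
      zero_le_power2[of u] zero_le_power2[of v] by argo
  finally have pos: "u\<^sup>2 - u * v + v\<^sup>2 > 0" .
  \<comment> \<open>Strictness has to come from this summand, since the other one vanishes when
    \<open>u = t * v\<close>.\<close>
  have "p * (1 - t + t\<^sup>2)\<^sup>2 * (u\<^sup>2 - u * v + v\<^sup>2) > 0"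
    using assms(3) pos one_minus_plus_square_pos[of t] by simp
  moreover have "(t\<^sup>2 * u + v) * (u - t * v)\<^sup>2 \<ge> 0"
    using uv by simp
  ultimately show ?thesis
    unfolding uv(1,2) choi_det_shift using assms(2) by (intro mult_pos_pos) auto
qed

lemma choi_det_pos:
  assumes "t > 0" "t \<noteq> 1" "p > 0" "q > 0" "r > 0" "\<not> (p = q \<and> q = r)"
  shows "choi_det t p q r > 0"
proof -
  consider "p \<le> q \<and> p \<le> r" | "q \<le> p \<and> q \<le> r" | "r \<le> p \<and> r \<le> q" by linarith
  then show ?thesis
  proof cases
    case 1
    then show ?thesis using choi_det_pos_min[of t p q r] assms by auto
  next
    case 2
    then show ?thesis using choi_det_pos_min[of t q r p] choi_det_cyclic[of t q r p] assms by auto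
  next
    case 3
    then show ?thesis using choi_det_pos_min[of t r p q] choi_det_cyclic[of t p q r]
       choi_det_cyclic[of t r p q] assms by auto
  qed
qed

text \<open>Lagrange's completion of squares in \<open>Y1\<close>, \<open>Y2\<close>,
  \<open>Y3\<close>, multiplied by \<open>E * A\<close> to avoid division. \<open>A\<close>,
  \<open>E\<close> and \<open>choi_det\<close> are the leading principal minors of the form.\<close>

lemma choi_form_complete_square:
  fixes t X1 X2 X3 Y1 Y2 Y3 :: real
  defines "s \<equiv> (1 - t)\<^sup>2" and "D \<equiv> 1 - t + t\<^sup>2"
  defines "A \<equiv> s * X1\<^sup>2 + t\<^sup>2 * X2\<^sup>2 + X3\<^sup>2" and "B \<equiv> X1\<^sup>2 + s * X2\<^sup>2 + t\<^sup>2 * X3\<^sup>2"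
  defines "E \<equiv> A * B - D\<^sup>2 * X1\<^sup>2 * X2\<^sup>2"
  shows "E * A * choi_form t X1 X2 X3 Y1 Y2 Y3 =
      E * (A * Y1 - D * X1 * (X2 * Y2 + X3 * Y3))\<^sup>2
    + (E * Y2 - D * X2 * X3 * (A + D * X1\<^sup>2) * Y3)\<^sup>2
    + A * choi_det t (X1\<^sup>2) (X2\<^sup>2) (X3\<^sup>2) * Y3\<^sup>2"
proof -
  define C where "C = t\<^sup>2 * X1\<^sup>2 + X2\<^sup>2 + s * X3\<^sup>2"
  have "choi_form t X1 X2 X3 Y1 Y2 Y3 = Y1\<^sup>2 * A + Y2\<^sup>2 * B + Y3\<^sup>2 * C
      - 2 * D * (X1 * X2 * Y1 * Y2 + X2 * X3 * Y2 * Y3 + X3 * X1 * Y3 * Y1)"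
    unfolding choi_form_def A_def B_def C_def D_def s_def by simp
  moreover have "choi_det t (X1\<^sup>2) (X2\<^sup>2) (X3\<^sup>2) = A * B * C
      - D\<^sup>2 * (A * X2\<^sup>2 * X3\<^sup>2 + B * X1\<^sup>2 * X3\<^sup>2 + C * X1\<^sup>2 * X2\<^sup>2) - 2 * D ^ 3 * (X1\<^sup>2 * X2\<^sup>2 * X3\<^sup>2)"
    unfolding choi_det_def A_def B_def C_def D_def s_def by simp
  ultimately show ?thesis
    unfolding E_def by algebra
qed

text \<open>This is the minor \<open>E\<close> above. Its value at \<open>r = 0\<close> is the
  square \<open>(1 - t)\<^sup>2 * (p - t * q)\<^sup>2\<close>, and the remaining terms are positive
  because \<open>r > 0\<close>.\<close>

lemma choi_minor_pos:
  fixes t p q r :: real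
  assumes "t > 0" "p > 0" "q > 0" "r > 0"
  shows "((1 - t)\<^sup>2 * p + t\<^sup>2 * q + r) * (p + (1 - t)\<^sup>2 * q + t\<^sup>2 * r) - (1 - t + t\<^sup>2)\<^sup>2 * p * q > 0"
proof -
  have "((1 - t)\<^sup>2 * p + t\<^sup>2 * q + r) * (p + (1 - t)\<^sup>2 * q + t\<^sup>2 * r) - (1 - t + t\<^sup>2)\<^sup>2 * p * q
     = (1 - t)\<^sup>2 * (p - t * q)\<^sup>2 + t\<^sup>2 * r * ((1 - t)\<^sup>2 * p + t\<^sup>2 * q + r) + r * (p + (1 - t)\<^sup>2 * q)"
    by algebra
  also have "\<dots> > 0"
    using assms
    by (intro add_nonneg_pos add_nonneg_nonneg mult_nonneg_nonneg mult_pos_pos add_pos_nonneg) auto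
  finally show ?thesis .
qed

text \<open>If all \<open>X\<close> agree, the determinant vanishes and the form is a multiple of a
  sum of squared differences. Otherwise all leading minors are positive and the form is
  definite.\<close>

lemma choi_form_interior:
  assumes "t > 0" "t \<noteq> 1" "X1 > 0" "X2 > 0" "X3 > 0"
  shows "choi_form t X1 X2 X3 Y1 Y2 Y3 \<ge> 0"
    and "choi_form t X1 X2 X3 Y1 Y2 Y3 = 0 \<Longrightarrow>
           Y1 = 0 \<and> Y2 = 0 \<and> Y3 = 0 \<or> X1 = X2 \<and> X2 = X3 \<and> Y1 = Y2 \<and> Y2 = Y3"
proof -
  define D where "D = 1 - t + t\<^sup>2"
  have D: "D > 0" using one_minus_plus_square_pos unfolding D_def .
  have "choi_form t X1 X2 X3 Y1 Y2 Y3 \<ge> 0 \<and> (choi_form t X1 X2 X3 Y1 Y2 Y3 = 0 \<longrightarrow>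
           Y1 = 0 \<and> Y2 = 0 \<and> Y3 = 0 \<or> X1 = X2 \<and> X2 = X3 \<and> Y1 = Y2 \<and> Y2 = Y3)"
  proof (cases "X1 = X2 \<and> X2 = X3")
    case True
    then have X: "X2 = X1" "X3 = X1" by simp_all
    have eq: "choi_form t X1 X2 X3 Y1 Y2 Y3 =
        D * X1\<^sup>2 * ((Y1 - Y2)\<^sup>2 + (Y2 - Y3)\<^sup>2 + (Y3 - Y1)\<^sup>2)"
      unfolding choi_form_def D_def X by algebra
    have sq: "(Y1 - Y2)\<^sup>2 + (Y2 - Y3)\<^sup>2 + (Y3 - Y1)\<^sup>2 = 0 \<longrightarrow> Y1 = Y2 \<and> Y2 = Y3"
    proof
      assume "(Y1 - Y2)\<^sup>2 + (Y2 - Y3)\<^sup>2 + (Y3 - Y1)\<^sup>2 = 0"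
      then have "(Y1 - Y2)\<^sup>2 = 0" "(Y2 - Y3)\<^sup>2 = 0"
        using zero_le_power2[of "Y1 - Y2"] zero_le_power2[of "Y2 - Y3"] zero_le_power2[of "Y3 - Y1"]
        by linarith+
      then show "Y1 = Y2 \<and> Y2 = Y3" by simp
    qed
    show ?thesis
      unfolding eq using D assms(3) sq True by auto
  next
    case False
    define A where "A = (1 - t)\<^sup>2 * X1\<^sup>2 + t\<^sup>2 * X2\<^sup>2 + X3\<^sup>2"
    define E where "E = A * (X1\<^sup>2 + (1 - t)\<^sup>2 * X2\<^sup>2 + t\<^sup>2 * X3\<^sup>2) - D\<^sup>2 * X1\<^sup>2 * X2\<^sup>2"
    define d where "d = choi_det t (X1\<^sup>2) (X2\<^sup>2) (X3\<^sup>2)"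
    have A: "A > 0" unfolding A_def using assms by (intro add_nonneg_pos) auto
    have E: "E > 0" unfolding E_def A_def D_def using choi_minor_pos[of t "X1\<^sup>2" "X2\<^sup>2" "X3\<^sup>2"] assms
      by simp
    have d: "d > 0" unfolding d_def using False assms
      by (intro choi_det_pos) (auto simp: power2_eq_iff)
    have eq: "E * A * choi_form t X1 X2 X3 Y1 Y2 Y3 =
      E * (A * Y1 - D * X1 * (X2 * Y2 + X3 * Y3))\<^sup>2
    + (E * Y2 - D * X2 * X3 * (A + D * X1\<^sup>2) * Y3)\<^sup>2 + A * d * Y3\<^sup>2"
      unfolding E_def A_def D_def d_def by (rule choi_form_complete_square)
    have ge: "E * (A * Y1 - D * X1 * (X2 * Y2 + X3 * Y3))\<^sup>2 \<ge> 0"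
      "(E * Y2 - D * X2 * X3 * (A + D * X1\<^sup>2) * Y3)\<^sup>2 \<ge> 0" "A * d * Y3\<^sup>2 \<ge> 0"
      using A E d by auto
    have "E * A * choi_form t X1 X2 X3 Y1 Y2 Y3 \<ge> 0" using eq ge by linarith
    then have nn: "choi_form t X1 X2 X3 Y1 Y2 Y3 \<ge> 0"
      using mult_pos_pos[OF E A] by (metis zero_le_mult_iff not_less)
    moreover have "Y1 = 0 \<and> Y2 = 0 \<and> Y3 = 0" if "choi_form t X1 X2 X3 Y1 Y2 Y3 = 0"
    proof -
      have z: "E * (A * Y1 - D * X1 * (X2 * Y2 + X3 * Y3))\<^sup>2 = 0"
        "(E * Y2 - D * X2 * X3 * (A + D * X1\<^sup>2) * Y3)\<^sup>2 = 0" "A * d * Y3\<^sup>2 = 0"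
        using eq[unfolded that] ge by linarith+
      have "Y3 = 0" using z(3) A d by simp
      moreover from this have "Y2 = 0" using z(2) E by simp
      ultimately show ?thesis using z(1) E A by simp
    qed
    ultimately show ?thesis by blast
  qed
  then show "choi_form t X1 X2 X3 Y1 Y2 Y3 \<ge> 0"
    and "choi_form t X1 X2 X3 Y1 Y2 Y3 = 0 \<Longrightarrow>
           Y1 = 0 \<and> Y2 = 0 \<and> Y3 = 0 \<or> X1 = X2 \<and> X2 = X3 \<and> Y1 = Y2 \<and> Y2 = Y3"
    by blast+
qed

text \<open>For \<open>X3 = 0\<close> the variable \<open>Y3\<close> decouples. The remaining binary
  form in \<open>Y1\<close>, \<open>Y2\<close> has determinant
  \<open>s * (X1\<^sup>2 - t * X2\<^sup>2)\<^sup>2\<close>, which is the source of the ratio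
  \<open>t\<close> in the zero set.\<close>

lemma choi_form_boundary:
  assumes "t > 0" "t \<noteq> 1" "X1 \<ge> 0" "X2 \<ge> 0"
  shows "choi_form t X1 X2 0 Y1 Y2 Y3 \<ge> 0"
    and "choi_form t X1 X2 0 Y1 Y2 Y3 = 0 \<Longrightarrow>
           X1 = 0 \<and> X2 = 0 \<or> Y1 = 0 \<and> Y2 = 0 \<and> Y3 = 0 \<or>
           Y3 = 0 \<and> X1\<^sup>2 = t * X2\<^sup>2 \<and> Y2\<^sup>2 = t * Y1\<^sup>2"
proof -
  define D where "D = 1 - t + t\<^sup>2"
  define s where "s = (1 - t)\<^sup>2"
  define A where "A = s * X1\<^sup>2 + t\<^sup>2 * X2\<^sup>2"
  define C where "C = t\<^sup>2 * X1\<^sup>2 + X2\<^sup>2"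
  have D: "D > 0" using one_minus_plus_square_pos unfolding D_def .
  have s: "s > 0" using assms unfolding s_def by simp
  define B where "B = X1\<^sup>2 + s * X2\<^sup>2"
  have "choi_form t X1 X2 0 Y1 Y2 Y3 = Y1\<^sup>2 * A + Y2\<^sup>2 * B + Y3\<^sup>2 * C - 2 * D * (X1 * X2 * Y1 * Y2)"
    unfolding choi_form_def A_def B_def C_def s_def D_def by simp
  moreover have "A * B - D\<^sup>2 * X1\<^sup>2 * X2\<^sup>2 = s * (X1\<^sup>2 - t * X2\<^sup>2)\<^sup>2"
    unfolding A_def B_def s_def D_def by algebra
  ultimately have eq: "A * choi_form t X1 X2 0 Y1 Y2 Y3 =
      (A * Y1 - D * X1 * X2 * Y2)\<^sup>2 + s * (X1\<^sup>2 - t * X2\<^sup>2)\<^sup>2 * Y2\<^sup>2 + A * C * Y3\<^sup>2"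
    by algebra
  have "choi_form t X1 X2 0 Y1 Y2 Y3 \<ge> 0 \<and> (choi_form t X1 X2 0 Y1 Y2 Y3 = 0 \<longrightarrow>
           X1 = 0 \<and> X2 = 0 \<or> Y1 = 0 \<and> Y2 = 0 \<and> Y3 = 0 \<or>
           Y3 = 0 \<and> X1\<^sup>2 = t * X2\<^sup>2 \<and> Y2\<^sup>2 = t * Y1\<^sup>2)"
  proof (cases "X1 = 0 \<and> X2 = 0")
    case True
    then show ?thesis by (simp add: choi_form_def)
  next
    case False
    have A: "A > 0" unfolding A_def using False s assms(1)
      by (metis add_nonneg_pos add_pos_nonneg less_eq_real_def mult_pos_pos mult_zero_right zero_less_power2 zero_le_power2 zero_le_mult_iff)
    have C: "C > 0" unfolding C_def using False assms(1)
      by (metis add_nonneg_pos add_pos_nonneg less_eq_real_def mult_pos_pos mult_zero_right zero_less_power2 zero_le_power2 zero_le_mult_iff)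
    have ge: "(A * Y1 - D * X1 * X2 * Y2)\<^sup>2 \<ge> 0" "s * (X1\<^sup>2 - t * X2\<^sup>2)\<^sup>2 * Y2\<^sup>2 \<ge> 0" "A * C * Y3\<^sup>2 \<ge> 0"
      using A C s by auto
    have "A * choi_form t X1 X2 0 Y1 Y2 Y3 \<ge> 0" using eq ge by linarith
    then have nn: "choi_form t X1 X2 0 Y1 Y2 Y3 \<ge> 0"
      using A by (simp add: zero_le_mult_iff)
    moreover have "Y1 = 0 \<and> Y2 = 0 \<and> Y3 = 0 \<or>
           Y3 = 0 \<and> X1\<^sup>2 = t * X2\<^sup>2 \<and> Y2\<^sup>2 = t * Y1\<^sup>2" if "choi_form t X1 X2 0 Y1 Y2 Y3 = 0"
    proof -
      have z: "(A * Y1 - D * X1 * X2 * Y2)\<^sup>2 = 0" "s * (X1\<^sup>2 - t * X2\<^sup>2)\<^sup>2 * Y2\<^sup>2 = 0" "A * C * Y3\<^sup>2 = 0"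
        using eq[unfolded that] ge by linarith+
      have Y3: "Y3 = 0" using z(3) A C by simp
      have Y1: "A * Y1 = D * X1 * X2 * Y2" using z(1) by simp
      show ?thesis
      proof (cases "Y2 = 0")
        case True
        then show ?thesis using Y1 Y3 A by simp
      next
        case Y2: False
        then have X: "X1\<^sup>2 = t * X2\<^sup>2" using z(2) s by simp
        then have X2: "X2 > 0" using False assms by (cases "X2 = 0") auto
        \<comment> \<open>With this value of \<open>A\<close> the kernel equation \<open>Y1\<close>
          reduces to \<open>t * X2 * Y1 = X1 * Y2\<close>; squaring it yields the ratio of the
          \<open>Y\<close>.\<close>
        have "A = t * X2\<^sup>2 * D" unfolding A_def X s_def D_def by algebra
        then have "D * X2 * (t * X2 * Y1) = D * X2 * (X1 * Y2)" using Y1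
          by (simp add: power2_eq_square algebra_simps)
        then have "t * X2 * Y1 = X1 * Y2" using D X2 by simp
        then have "t\<^sup>2 * X2\<^sup>2 * Y1\<^sup>2 = t * X2\<^sup>2 * Y2\<^sup>2" using X
          by (metis power_mult_distrib)
        then have "(t * X2\<^sup>2) * (t * Y1\<^sup>2) = (t * X2\<^sup>2) * Y2\<^sup>2"
          by (simp add: power2_eq_square algebra_simps)
        then have "Y2\<^sup>2 = t * Y1\<^sup>2" using X2 assms(1) by simp
        then show ?thesis using Y3 X by simp
      qed
    qed
    ultimately show ?thesis by blast
  qed
  then show "choi_form t X1 X2 0 Y1 Y2 Y3 \<ge> 0"
    and "choi_form t X1 X2 0 Y1 Y2 Y3 = 0 \<Longrightarrow>
           X1 = 0 \<and> X2 = 0 \<or> Y1 = 0 \<and> Y2 = 0 \<and> Y3 = 0 \<or>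
           Y3 = 0 \<and> X1\<^sup>2 = t * X2\<^sup>2 \<and> Y2\<^sup>2 = t * Y1\<^sup>2"
    by blast+
qed

lemma choi_form_nonneg:
  assumes "t > 0" "t \<noteq> 1" "X1 \<ge> 0" "X2 \<ge> 0" "X3 \<ge> 0"
  shows "choi_form t X1 X2 X3 Y1 Y2 Y3 \<ge> 0"
  using choi_form_interior(1)[OF assms(1,2), of X1 X2 X3 Y1 Y2 Y3]
    choi_form_boundary(1)[OF assms(1,2), of X1 X2 Y1 Y2 Y3]
    choi_form_boundary(1)[OF assms(1,2), of X2 X3 Y2 Y3 Y1] choi_form_cyclic[of t X2 X3 X1 Y2 Y3 Y1]
    choi_form_boundary(1)[OF assms(1,2), of X3 X1 Y3 Y1 Y2] choi_form_cyclic[of t X3 X1 X2 Y3 Y1 Y2]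
    choi_form_cyclic[of t X1 X2 X3 Y1 Y2 Y3] assms(3-5)
  by (metis order_le_less)

text \<open>Either all \<open>X\<close> are positive, or some \<open>X\<close> vanishes and a cyclic
  shift brings it to the third place.\<close>

lemma choi_form_zero_cases:
  assumes "t > 0" "t \<noteq> 1" "X1 \<ge> 0" "X2 \<ge> 0" "X3 \<ge> 0" "choi_form t X1 X2 X3 Y1 Y2 Y3 = 0"
  obtains "X1 = 0" "X2 = 0" "X3 = 0"
  | "Y1 = 0" "Y2 = 0" "Y3 = 0"
  | "X1 = X2" "X2 = X3" "Y1 = Y2" "Y2 = Y3"
  | "X3 = 0" "Y3 = 0" "X1\<^sup>2 = t * X2\<^sup>2" "Y2\<^sup>2 = t * Y1\<^sup>2"
  | "X1 = 0" "Y1 = 0" "X2\<^sup>2 = t * X3\<^sup>2" "Y3\<^sup>2 = t * Y2\<^sup>2"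
  | "X2 = 0" "Y2 = 0" "X3\<^sup>2 = t * X1\<^sup>2" "Y1\<^sup>2 = t * Y3\<^sup>2"
proof -
  consider "X1 > 0 \<and> X2 > 0 \<and> X3 > 0" | "X3 = 0" | "X1 = 0" | "X2 = 0"
    using assms(3-5) by linarith
  then show thesis
  proof cases
    case 1
    then show thesis
      using choi_form_interior(2)[OF assms(1,2), of X1 X2 X3 Y1 Y2 Y3] assms(6) that by blast
  next
    case 2
    then show thesis
      using choi_form_boundary(2)[OF assms(1,2), of X1 X2 Y1 Y2 Y3] assms that by blast
  next
    case 3
    then have "choi_form t X2 X3 0 Y2 Y3 Y1 = 0"
      using assms(6) choi_form_cyclic[of t X2 X3 X1 Y2 Y3 Y1] by (metis choi_form_cyclic)
    then show thesis
      using choi_form_boundary(2)[OF assms(1,2), of X2 X3 Y2 Y3 Y1] assms 3 that by blast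
  next
    case 4
    then have "choi_form t X3 X1 0 Y3 Y1 Y2 = 0"
      using assms(6) by (metis choi_form_cyclic)
    then show thesis
      using choi_form_boundary(2)[OF assms(1,2), of X3 X1 Y3 Y1 Y2] assms 4 that by blast
  qed
qed

subsection \<open>Faces of the cone of separable states\<close>

lemma face_of_convex_cone_scaleR:
  assumes "convex_cone C" "F face_of C" "z \<in> F" "0 \<le> c"
  shows "c *\<^sub>R z \<in> F"
proof (cases "z = 0")
  case False
  \<comment> \<open>\<open>N > 1\<close> puts \<open>z\<close> strictly between 0 and
    \<open>N *\<^sub>R z\<close>, so both ends lie in the face; \<open>N > c\<close> then puts
    \<open>c *\<^sub>R z\<close> on the segment joining them.\<close>
  define N where "N = max 2 (c + 1)"
  have N: "N > 1" "N > c" unfolding N_def by auto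
  have zC: "z \<in> C" using assms(2,3) face_of_imp_subset by blast
  have "z \<in> open_segment 0 (N *\<^sub>R z)"
    unfolding in_segment using N False by (auto intro!: exI[of _ "1 / N"])
  moreover have "0 \<in> C" "N *\<^sub>R z \<in> C"
    using assms(1) zC N convex_cone_contains_0 convex_cone_scaleR[of C N z] by auto
  ultimately have F: "0 \<in> F" "N *\<^sub>R z \<in> F"
    using assms(2,3) unfolding face_of_def by blast+
  have "(1 - c / N) *\<^sub>R 0 + (c / N) *\<^sub>R (N *\<^sub>R z) \<in> F"
    using F face_of_imp_convex[OF assms(2)] N assms(4) by (intro convexD) auto
  then show ?thesis using N by simp
qed (use assms in simp)

text \<open>The sum is the midpoint of \<open>2 *\<^sub>R x\<close> and
  \<open>2 *\<^sub>R y\<close>. The case \<open>x = y\<close> is separate because the open segment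
  is then empty.\<close>

lemma face_of_convex_cone_add_left:
  assumes "convex_cone C" "F face_of C" "x \<in> C" "y \<in> C" "x + y \<in> F"
  shows "x \<in> F"
proof (cases "x = y")
  case True
  then have "x = (1/2) *\<^sub>R (x + y)" by (simp flip: scaleR_2)
  then show ?thesis using face_of_convex_cone_scaleR[OF assms(1,2,5), of "1/2"] by simp
next
  case False
  have "x + y \<in> open_segment (2 *\<^sub>R x) (2 *\<^sub>R y)"
    unfolding in_segment using False by (auto intro!: exI[of _ "1 / 2"])
  moreover have "2 *\<^sub>R x \<in> C" "2 *\<^sub>R y \<in> C"
    using assms(3,4) convex_cone_scaleR[OF assms(1), of 2] by simp_all
  ultimately have "2 *\<^sub>R x \<in> F"
    using assms(2,5) unfolding face_of_def by blast
  then show ?thesis using face_of_convex_cone_scaleR[OF assms(1,2), of "2 *\<^sub>R x" "1/2"] by simp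
qed

lemma face_of_convex_cone_add:
  assumes "convex_cone C" "F face_of C" "x \<in> F" "y \<in> F"
  shows "x + y \<in> F"
proof -
  have "(1/2) *\<^sub>R (2 *\<^sub>R x) + (1/2) *\<^sub>R (2 *\<^sub>R y) \<in> F"
    using face_of_imp_convex[OF assms(2)] face_of_convex_cone_scaleR[OF assms(1,2)] assms(3,4)
    by (intro convexD) auto
  then show ?thesis by simp
qed

section \<open>Product states and smallest faces of the cone \<open>V1\<close>\<close>

definition prod_state :: "complex ^ 3 \<Rightarrow> complex ^ 3 \<Rightarrow> M33" where
  "prod_state x y = rank_one (tensor_vec x y)"

lemma prod_state_nth:
  "prod_state x y $ p $ q = x $ fst p * y $ snd p * cnj (x $ fst q * y $ snd q)"
  by (simp add: prod_state_def rank_one_def tensor_vec_def)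

lemma zero_in_V1: "0 \<in> V1"
  unfolding V1_def by (force intro: exI[of _ "0::nat"])

lemma V1_add_prod_state:
  assumes "B \<in> V1"
  shows "B + prod_state x y \<in> V1"
proof -
  obtain n f g where B: "B = (\<Sum>k<(n::nat). rank_one (tensor_vec (f k) (g k)))"
    using assms unfolding V1_def by blast
  have "B + prod_state x y = (\<Sum>k<Suc n. rank_one (tensor_vec ((f(n := x)) k) ((g(n := y)) k)))"
    unfolding B prod_state_def by simp
  then show ?thesis unfolding V1_def by blast
qed

lemma V1_induct [consumes 1, case_names zero add]:
  assumes "B \<in> V1" "P 0" "\<And>B x y. B \<in> V1 \<Longrightarrow> P B \<Longrightarrow> P (B + prod_state x y)"
  shows "P B"
proof -
  obtain n f g where B: "B = (\<Sum>k<(n::nat). prod_state (f k) (g k))"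
    using assms(1) unfolding V1_def prod_state_def by blast
  have "(\<Sum>k<m. prod_state (f k) (g k)) \<in> V1 \<and> P (\<Sum>k<m. prod_state (f k) (g k))" for m :: nat
    by (induction m) (auto simp: zero_in_V1 assms(2,3) V1_add_prod_state)
  then show ?thesis unfolding B by blast
qed

lemma prod_state_in_V1: "prod_state x y \<in> V1"
  using V1_add_prod_state[OF zero_in_V1] by simp

lemma scaleR_prod_state: "0 \<le> c \<Longrightarrow> c *\<^sub>R prod_state x y = prod_state (sqrt c *\<^sub>R x) y"
proof -
  assume "0 \<le> c"
  then have "complex_of_real c = of_real (sqrt c) * of_real (sqrt c)"
    by (simp flip: of_real_mult)
  then show ?thesis
    unfolding vec_eq_iff prod_state_nth vector_scaleR_component by (simp add: scaleR_conv_of_real)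
qed

lemma V1_add: "B \<in> V1 \<Longrightarrow> A \<in> V1 \<Longrightarrow> A + B \<in> V1"
  by (induction B rule: V1_induct) (auto simp: V1_add_prod_state simp flip: add.assoc)

lemma convex_cone_V1: "convex_cone V1"
proof -
  have "c *\<^sub>R B \<in> V1" if "B \<in> V1" "0 \<le> c" for B c
    using that
    by (induction B rule: V1_induct)
      (auto simp: zero_in_V1 V1_add_prod_state scaleR_add_right scaleR_prod_state)
  then show ?thesis by (simp add: convex_cone_iff V1_add zero_in_V1)
qed

lemma V1_sum: "(\<And>i. i \<in> S \<Longrightarrow> f i \<in> V1) \<Longrightarrow> sum f S \<in> V1"
  by (induction S rule: infinite_finite_induct) (auto simp: zero_in_V1 V1_add)

text \<open>An intersection of a nonempty family of faces is a face. The family is nonempty because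
  \<open>V1\<close> is a face of itself and contains \<open>A\<close>.\<close>

lemma V1_face_face_of: "A \<in> V1 \<Longrightarrow> V1_face A face_of V1"
  unfolding V1_face_def hull_def
  using convex_cone_V1 by (intro face_of_Inter) (auto simp: convex_cone_def face_of_refl)

lemma self_in_V1_face: "A \<in> V1_face A"
  unfolding V1_face_def using hull_subset by fast

lemma V1_face_minimal: "F face_of V1 \<Longrightarrow> A \<in> F \<Longrightarrow> V1_face A \<subseteq> F"
  unfolding V1_face_def by (simp add: hull_minimal)

lemma V1_face_mono: "A \<in> V1 \<Longrightarrow> B \<in> V1_face A \<Longrightarrow> V1_face B \<subseteq> V1_face A"
  by (simp add: V1_face_minimal V1_face_face_of)

lemma zero_in_V1_face: "A \<in> V1 \<Longrightarrow> 0 \<in> V1_face A"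
  using face_of_convex_cone_scaleR[OF convex_cone_V1 V1_face_face_of self_in_V1_face, of A 0] by simp

text \<open>The basic way to enter a smallest face: split off a separable summand of a multiple of
  \<open>A\<close>. The factor \<open>c\<close> absorbs the normalisation of averages.\<close>

lemma V1_face_of_scaled_summand:
  assumes "A \<in> V1" "0 \<le> c" "B \<in> V1" "P \<in> V1" "c *\<^sub>R A = B + P"
  shows "B \<in> V1_face A"
  using face_of_convex_cone_add_left[OF convex_cone_V1 V1_face_face_of[OF assms(1)] assms(3,4)]
    face_of_convex_cone_scaleR[OF convex_cone_V1 V1_face_face_of[OF assms(1)] self_in_V1_face assms(2)]
    assms(5) by simp

lemma linear_nonneg_on_V1:
  assumes "linear L" "\<And>x y. (0::real) \<le> L (prod_state x y)" "B \<in> V1"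
  shows "0 \<le> L B"
  using assms(3)
  by (induction B rule: V1_induct) (auto simp: linear_0[OF assms(1)] linear_add[OF assms(1)] assms(2))

text \<open>Each functional is nonnegative on all of \<open>V1\<close>, so a convex combination with
  positive weights can be annihilated only if both end points are.\<close>

lemma zeros_face_of_V1:
  assumes lin: "\<And>L. L \<in> \<L> \<Longrightarrow> linear L"
    and nonneg: "\<And>L x y. L \<in> \<L> \<Longrightarrow> (0::real) \<le> L (prod_state x y)"
  shows "{B \<in> V1. \<forall>L\<in>\<L>. L B = 0} face_of V1"
  unfolding face_of_def
proof (intro conjI ballI impI)
  show "convex {B \<in> V1. \<forall>L\<in>\<L>. L B = 0}"
    using convex_cone_V1 unfolding convex_def convex_cone_iff
    by (auto simp: linear_add[OF lin] linear_scale[OF lin])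
next
  fix a b x
  assume ab: "a \<in> V1" "b \<in> V1" and x: "x \<in> {B \<in> V1. \<forall>L\<in>\<L>. L B = 0}"
    and seg: "x \<in> open_segment a b"
  obtain u where u: "0 < u" "u < 1" "x = (1 - u) *\<^sub>R a + u *\<^sub>R b"
    using seg unfolding in_segment by blast
  have "L a = 0 \<and> L b = 0" if L: "L \<in> \<L>" for L
  proof -
    have ge: "0 \<le> L a" "0 \<le> L b"
      using linear_nonneg_on_V1[of L] lin[OF L] nonneg[OF L] ab by auto
    have "(1 - u) * L a + u * L b = 0"
      using x L u(3) by (auto simp: linear_add[OF lin] linear_scale[OF lin])
    moreover have "0 \<le> (1 - u) * L a" "0 \<le> u * L b" using ge u by auto
    ultimately have "(1 - u) * L a = 0" "u * L b = 0" by linarith+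
    then show ?thesis using u by simp
  qed
  then show "a \<in> {B \<in> V1. \<forall>L\<in>\<L>. L B = 0}" "b \<in> {B \<in> V1. \<forall>L\<in>\<L>. L B = 0}"
    using ab by auto
qed auto

text \<open>The criterion behind all three claims; it reduces them to product vectors. If a
  functional that is nonnegative on \<open>V1\<close> kills a sum of product states, it kills every
  summand. By \<open>gen\<close> the summands lie in the face, which is closed under
  addition.\<close>

lemma V1_face_eq_zeros:
  assumes A: "A \<in> V1" "\<And>L. L \<in> \<L> \<Longrightarrow> L A = 0"
    and lin: "\<And>L. L \<in> \<L> \<Longrightarrow> linear L"
    and nonneg: "\<And>L x y. L \<in> \<L> \<Longrightarrow> (0::real) \<le> L (prod_state x y)"
    and gen: "\<And>x y. (\<And>L. L \<in> \<L> \<Longrightarrow> L (prod_state x y) = 0) \<Longrightarrow> prod_state x y \<in> V1_face A"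
  shows "V1_face A = {B \<in> V1. \<forall>L\<in>\<L>. L B = 0}"
proof
  show "V1_face A \<subseteq> {B \<in> V1. \<forall>L\<in>\<L>. L B = 0}"
    using A by (intro V1_face_minimal zeros_face_of_V1 lin nonneg) auto
  have "(\<forall>L\<in>\<L>. L B = 0) \<longrightarrow> B \<in> V1_face A" if "B \<in> V1" for B
    using that
  proof (induction B rule: V1_induct)
    case zero
    then show ?case using zero_in_V1_face[OF A(1)] by simp
  next
    case (add B x y)
    show ?case
    proof
      assume 0: "\<forall>L\<in>\<L>. L (B + prod_state x y) = 0"
      have "L B = 0 \<and> L (prod_state x y) = 0" if "L \<in> \<L>" for L
        using 0 that linear_nonneg_on_V1[OF lin[OF that] nonneg[OF that] add.hyps] nonneg[OF that, of x y]
        by (auto simp: linear_add[OF lin[OF that]] add_nonneg_eq_0_iff)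
      then show "B + prod_state x y \<in> V1_face A"
        using add.IH gen[of x y]
          face_of_convex_cone_add[OF convex_cone_V1 V1_face_face_of[OF A(1)]] by blast
    qed
  qed
  then show "{B \<in> V1. \<forall>L\<in>\<L>. L B = 0} \<subseteq> V1_face A" by blast
qed

section \<open>Range conditions as zero sets of nonnegative functionals\<close>

definition vdot :: "complex ^ 'n \<Rightarrow> complex ^ 'n \<Rightarrow> complex" where
  "vdot l v = (\<Sum>p\<in>UNIV. l $ p * v $ p)"

text \<open>Since \<open>vdot\<close> is bilinear, \<open>l\<close> is conjugated on the right; this
  makes the value on \<open>rank_one z\<close> the squared modulus of \<open>vdot l z\<close>. The
  real part makes it a real functional, as \<open>V1_face_eq_zeros\<close> demands.\<close>

definition quad :: "complex ^ 'n \<Rightarrow> complex ^ 'n ^ 'n \<Rightarrow> real" where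
  "quad l B = Re (vdot l (B *v (\<chi> q. cnj (l $ q))))"

lemma vdot_add: "vdot l (v + w) = vdot l v + vdot l w"
  by (simp add: vdot_def algebra_simps sum.distrib)

lemma vdot_rank_one: "vdot l (rank_one z *v v) = vdot l z * vdot (\<chi> q. cnj (z $ q)) v"
  unfolding vdot_def rank_one_def matrix_vector_mult_def sum_distrib_right
  by (simp add: sum_distrib_left mult.assoc)

lemma quad_rank_one: "quad l (rank_one z) = (cmod (vdot l z))\<^sup>2"
proof -
  have "vdot (\<chi> q. cnj (z $ q)) (\<chi> q. cnj (l $ q)) = cnj (vdot l z)"
    by (simp add: vdot_def mult.commute)
  then show ?thesis
    unfolding quad_def vdot_rank_one by (metis Re_complex_of_real complex_norm_square)
qed

lemma linear_quad: "linear (quad l)"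
proof (rule linearI)
  show "quad l (A + B) = quad l A + quad l B" for A B
    by (simp add: quad_def matrix_vector_mult_add_rdistrib vdot_add)
  show "quad l (c *\<^sub>R A) = c *\<^sub>R quad l A" for c A
    by (simp add: quad_def vdot_def matrix_vector_mult_def scaleR_sum_right sum_distrib_left algebra_simps)
qed

lemma quad_prod_state_nonneg: "0 \<le> quad l (prod_state x y)"
  by (simp add: prod_state_def quad_rank_one)

lemma quad_nonneg: "B \<in> V1 \<Longrightarrow> 0 \<le> quad l B"
  by (simp add: linear_nonneg_on_V1 linear_quad quad_prod_state_nonneg)

text \<open>On a sum of \<open>rank_one z\<close> the value of \<open>quad l\<close> is a sum of
  squared moduli of \<open>vdot l z\<close>; if it vanishes, \<open>l\<close> annihilates every
  \<open>z\<close>, hence the whole range. Thus a linear equation on the range becomes the vanishing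
  of one nonnegative functional.\<close>

lemma vdot_range_eq_0_iff:
  assumes "B \<in> V1"
  shows "(\<forall>v. vdot l (B *v v) = 0) \<longleftrightarrow> quad l B = 0"
proof
  assume "quad l B = 0"
  moreover have "quad l B = 0 \<longrightarrow> (\<forall>v. vdot l (B *v v) = 0)"
    using assms
  proof (induction B rule: V1_induct)
    case zero
    then show ?case by (simp add: vdot_def)
  next
    case (add B x y)
    show ?case
    proof
      assume "quad l (B + prod_state x y) = 0"
      then have "quad l B = 0 \<and> quad l (prod_state x y) = 0"
        using quad_nonneg[OF add.hyps, of l] quad_prod_state_nonneg[of l x y]
        by (simp add: linear_add[OF linear_quad] add_nonneg_eq_0_iff)
      then show "\<forall>v. vdot l ((B + prod_state x y) *v v) = 0"
        using add.IH
        by (simp add: matrix_vector_mult_add_rdistrib vdot_add prod_state_def vdot_rank_one quad_rank_one)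
    qed
  qed
  ultimately show "\<forall>v. vdot l (B *v v) = 0" by blast
qed (simp add: quad_def)

lemma linear_partial_transpose: "linear partial_transpose"
  by (rule linearI) (simp_all add: partial_transpose_def vec_eq_iff)

lemma partial_transpose_prod_state:
  "partial_transpose (prod_state x y) = prod_state (\<chi> i. cnj (x $ i)) y"
  by (simp add: vec_eq_iff partial_transpose_def prod_state_nth algebra_simps)

lemma partial_transpose_V1: "B \<in> V1 \<Longrightarrow> partial_transpose B \<in> V1"
  by (induction B rule: V1_induct)
    (auto simp: linear_0[OF linear_partial_transpose] linear_add[OF linear_partial_transpose]
      zero_in_V1 partial_transpose_prod_state V1_add_prod_state)

lemma V1_pos_semidef:
  assumes "B \<in> V1"
  shows "pos_semidef B"
  unfolding pos_semidef_def
proof (intro conjI allI)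
  show "B $ q $ p = cnj (B $ p $ q)" for p q
    using assms by (induction B rule: V1_induct) (auto simp: prod_state_nth)
  show "0 \<le> Re (\<Sum>p\<in>UNIV. cnj (x $ p) * (B *v x) $ p)" for x
    using quad_nonneg[OF assms, of "\<chi> q. cnj (x $ q)"] by (simp add: quad_def vdot_def)
qed

text \<open>Separable states are PPT, so only the two range inclusions remain, and these turn into
  functionals once both ranges are given by linear equations.\<close>

lemma V1_Int_PPT_face:
  assumes "mat_range A = {v. \<forall>l\<in>\<Lambda>. vdot l v = 0}"
    and "mat_range (partial_transpose A) = {v. \<forall>l\<in>\<Lambda>'. vdot l v = 0}"
  shows "V1 \<inter> PPT_face A =
    {B \<in> V1. \<forall>L \<in> quad ` \<Lambda> \<union> (\<lambda>l B. quad l (partial_transpose B)) ` \<Lambda>'. L B = 0}"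
proof -
  have range: "mat_range B \<subseteq> {v. \<forall>l\<in>\<Lambda>. vdot l v = 0} \<longleftrightarrow> (\<forall>l\<in>\<Lambda>. quad l B = 0)"
    if "B \<in> V1" for B \<Lambda>
    using vdot_range_eq_0_iff[OF that] unfolding mat_range_def by blast
  have "V1 \<inter> PPT_face A = {B \<in> V1. mat_range B \<subseteq> {v. \<forall>l\<in>\<Lambda>. vdot l v = 0} \<and>
      mat_range (partial_transpose B) \<subseteq> {v. \<forall>l\<in>\<Lambda>'. vdot l v = 0}}"
    unfolding PPT_face_def assms PPT_def using partial_transpose_V1 V1_pos_semidef by blast
  also have "\<dots> = {B \<in> V1. (\<forall>l\<in>\<Lambda>. quad l B = 0) \<and> (\<forall>l\<in>\<Lambda>'. quad l (partial_transpose B) = 0)}"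
    using range partial_transpose_V1 by (intro Collect_cong conj_cong refl) blast+
  finally show ?thesis by (simp add: ball_Un)
qed

subsection \<open>Averaging over diagonal unitaries\<close>

lemma index_3_distinct:
  "(1::3) = 2 \<longleftrightarrow> False" "(2::3) = 1 \<longleftrightarrow> False" "(1::3) = 3 \<longleftrightarrow> False"
  "(3::3) = 1 \<longleftrightarrow> False" "(2::3) = 3 \<longleftrightarrow> False" "(3::3) = 2 \<longleftrightarrow> False"
  by simp_all

lemma sum_3_times_3: "(\<Sum>p\<in>(UNIV::(3 \<times> 3) set). f p) = (\<Sum>i\<in>UNIV. \<Sum>k\<in>UNIV. f (i, k))"
  by (simp add: sum.cartesian_product flip: UNIV_Times_UNIV)

definition cube_root :: "nat \<Rightarrow> complex" where
  "cube_root a = (if a = 0 then 1 else if a = 1 then Complex (-1/2) (sqrt 3 / 2)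
                  else Complex (-1/2) (- sqrt 3 / 2))"

definition phase :: "3 \<Rightarrow> nat \<Rightarrow> 3 \<Rightarrow> complex" where
  "phase j a k = (if k = j then cube_root a else 1)"

text \<open>The summand is a power of \<open>cube_root a\<close>, and the sum of its values is 3 if
  the exponent is 0, and 0 otherwise. The exponent is a difference of two counts; the condition
  compares the counts to avoid subtraction of naturals.\<close>

lemma phase_sum:
  "(\<Sum>a<3. phase j a k * cnj (phase j a l) * cnj (phase j a k') * phase j a l') =
     (if of_bool (k = j) + of_bool (l' = j) = (of_bool (l = j) + of_bool (k' = j) :: nat) then 3 else 0)"
proof -
  define w where "w = Complex (-1/2) (sqrt 3 / 2)"
  have cr: "cube_root 0 = 1" "cube_root (Suc 0) = w" "cube_root (Suc (Suc 0)) = cnj w"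
    by (simp_all add: cube_root_def w_def complex_eq_iff)
  have w: "w * w = cnj w" "cnj w * cnj w = w" "w * cnj w = 1" "cnj w * w = 1"
    "1 + w + cnj w = 0" "1 + cnj w + w = 0"
    by (simp_all add: w_def complex_eq_iff)
  show ?thesis
    by (cases "k = j"; cases "l = j"; cases "k' = j"; cases "l' = j")
      (simp_all add: phase_def numeral_3_eq_3 cr w)
qed

text \<open>
  The average of \<open>zz\<^sup>*\<close> over all \<open>U \<otimes> cnj U\<close> with \<open>U\<close> a diagonal unitary. Cube roots of unity suffice
  for the averaging, because the characters involved have exponents between \<open>-2\<close> and \<open>2\<close>.
\<close>

definition twirl :: "complex ^ 3 \<Rightarrow> complex ^ 3 \<Rightarrow> M33" where
  "twirl x y = (\<chi> p q. if p = q \<or> fst p = snd p \<and> fst q = snd q then prod_state x y $ p $ q else 0)"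

text \<open>A global phase cancels between the two tensor factors, so level 1 can keep phase 1 and
  only levels 2 and 3 are rotated.\<close>

definition rotate_left :: "nat \<times> nat \<Rightarrow> complex ^ 3 \<Rightarrow> complex ^ 3" where
  "rotate_left ab x = (\<chi> k. phase 2 (fst ab) k * phase 3 (snd ab) k * x $ k)"

definition rotate_right :: "nat \<times> nat \<Rightarrow> complex ^ 3 \<Rightarrow> complex ^ 3" where
  "rotate_right ab y = (\<chi> k. cnj (phase 2 (fst ab) k * phase 3 (snd ab) k) * y $ k)"

text \<open>The left side says that \<open>k, l'\<close> and \<open>l, k'\<close> agree as
  multisets: the count at level 1 follows from those at 2 and 3, as both multisets have size
  two.\<close>

lemma phase_indices:
  fixes k l k' l' :: 3
  shows "of_bool (k = 2) + of_bool (l' = 2) = (of_bool (l = 2) + of_bool (k' = 2) :: nat) \<and>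
     of_bool (k = 3) + of_bool (l' = 3) = (of_bool (l = 3) + of_bool (k' = 3) :: nat) \<longleftrightarrow>
     (k, l) = (k', l') \<or> k = l \<and> k' = l'"
proof -
  have "\<forall>k l k' l' :: 3.
     (of_bool (k = 2) + of_bool (l' = 2) = (of_bool (l = 2) + of_bool (k' = 2) :: nat) \<and>
     of_bool (k = 3) + of_bool (l' = 3) = (of_bool (l = 3) + of_bool (k' = 3) :: nat)) \<longleftrightarrow>
     (k, l) = (k', l') \<or> k = l \<and> k' = l'"
    unfolding forall_3 by simp
  then show ?thesis by blast
qed

lemma sum_rotations:
  "(\<Sum>ab\<in>{..<3} \<times> {..<3}. prod_state (rotate_left ab x) (rotate_right ab y)) = 9 *\<^sub>R twirl x y"
proof -
  have "(\<Sum>ab\<in>{..<3} \<times> {..<3}. prod_state (rotate_left ab x) (rotate_right ab y)) $ (k, l) $ (k', l')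
      = (9 *\<^sub>R twirl x y) $ (k, l) $ (k', l')" for k l k' l'
  proof -
    define g where "g j a = phase j a k * cnj (phase j a l) * cnj (phase j a k') * phase j a l'" for j a
    have "(\<Sum>ab\<in>{..<3} \<times> {..<3}. prod_state (rotate_left ab x) (rotate_right ab y)) $ (k, l) $ (k', l')
        = (\<Sum>a<3. \<Sum>b<3. g 2 a * g 3 b * prod_state x y $ (k, l) $ (k', l'))"
      unfolding sum.cartesian_product
      by (simp add: sum_component prod_state_nth rotate_left_def rotate_right_def g_def mult_ac
          case_prod_unfold)
    also have "\<dots> = (\<Sum>a<3. g 2 a) * (\<Sum>b<3. g 3 b) * prod_state x y $ (k, l) $ (k', l')"
      unfolding sum_product unfolding sum_distrib_right by (rule refl)
    also have "\<dots> = (9 *\<^sub>R twirl x y) $ (k, l) $ (k', l')"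
      unfolding g_def phase_sum using phase_indices[of k l' l k']
      by (auto simp: twirl_def scaleR_conv_of_real)
    finally show ?thesis .
  qed
  then show ?thesis by (simp only: vec_eq_iff split_paired_All) blast
qed

lemma twirl_in_V1: "twirl x y \<in> V1"
proof -
  have "twirl x y = (1/9) *\<^sub>R (\<Sum>ab\<in>{..<3} \<times> {..<3}. prod_state (rotate_left ab x) (rotate_right ab y))"
    unfolding sum_rotations by simp
  also have "\<dots> \<in> V1"
    by (intro convex_cone_scaleR[OF convex_cone_V1] V1_sum prod_state_in_V1) simp
  finally show ?thesis .
qed

text \<open>The rotation with exponents \<open>(0, 0)\<close> is the identity, so the product state
  is one of the nine summands of the average.\<close>

lemma prod_state_in_V1_face_twirl: "prod_state x y \<in> V1_face (twirl x y)"
proof (rule V1_face_of_scaled_summand[where c = 9])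
  let ?P = "\<Sum>ab\<in>{..<3} \<times> {..<3} - {(0, 0)}. prod_state (rotate_left ab x) (rotate_right ab y)"
  have "rotate_left (0, 0) x = x" "rotate_right (0, 0) y = y"
    by (simp_all add: rotate_left_def rotate_right_def phase_def cube_root_def vec_eq_iff)
  then show "9 *\<^sub>R twirl x y = prod_state x y + ?P"
    unfolding sum_rotations[symmetric] by (subst sum.remove[of _ "(0, 0)"]) auto
  show "?P \<in> V1" by (intro V1_sum prod_state_in_V1)
qed (simp_all add: twirl_in_V1 prod_state_in_V1)

lemma prod_state_in_V1_face:
  assumes A: "A \<in> V1" and B: "B \<in> V1_face A" "twirl x y = c *\<^sub>R B" "0 \<le> c"
  shows "prod_state x y \<in> V1_face A"
proof -
  have "twirl x y \<in> V1_face A"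
    unfolding B(2)
    using face_of_convex_cone_scaleR[OF convex_cone_V1 V1_face_face_of[OF A]] B by blast
  then show ?thesis
    using V1_face_mono[OF A] prod_state_in_V1_face_twirl by blast
qed

section \<open>Circular and two-level vectors and their averages\<close>

lemma A_mat_nth:
  "A_mat (a, b, c) $ p $ q =
     (if p = q then of_real (if fst p = snd p then a else if p \<in> {(1, 2), (2, 3), (3, 1)} then c else b)
      else if fst p = snd p \<and> fst q = snd q then 1 else 0)"
proof -
  have "\<forall>i k. (vector [vector [a, c, b], vector [b, a, c], vector [c, b, a]] :: real ^ 3 ^ 3) $ i $ k =
      (if i = k then a else if (i, k) \<in> {(1, 2), (2, 3), (3, 1)} then c else b)"
    unfolding forall_3 by (simp add: vector_3 index_3_distinct)
  then show ?thesis by (simp del: insert_iff)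
qed

declare A_mat.simps [simp del]

lemma A_mat_1_nth:
  "A_mat (1, 1, 1) $ p $ q = (if p = q \<or> fst p = snd p \<and> fst q = snd q then 1 else 0)"
  by (simp add: A_mat_nth)

definition circular_pair :: "complex ^ 3 \<Rightarrow> complex ^ 3 \<Rightarrow> bool" where
  "circular_pair x y \<longleftrightarrow> (\<forall>k l. cmod (x $ k) = cmod (x $ l)) \<and> (\<forall>k l. x $ k * y $ k = x $ l * y $ l)"

lemma twirl_circular_pair:
  assumes "circular_pair x y"
  shows "twirl x y = (cmod (x $ 1 * y $ 1))\<^sup>2 *\<^sub>R A_mat (1, 1, 1)"
proof -
  have xy: "x $ k * y $ k = x $ 1 * y $ 1" and c: "cmod (x $ k) = cmod (x $ l)" for k l
    using assms unfolding circular_pair_def by blast+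
  have "(twirl x y) $ (k, l) $ (k', l') = ((cmod (x $ 1 * y $ 1))\<^sup>2 *\<^sub>R A_mat (1, 1, 1)) $ (k, l) $ (k', l')"
    for k l k' l'
  proof (cases "(k, l) = (k', l')")
    case True
    \<comment> \<open>Equal moduli in \<open>x\<close> allow \<open>x $ k\<close> to be replaced by
      \<open>x $ l\<close>, so every diagonal entry has the common value.\<close>
    have "cmod (x $ k * y $ l) = cmod (x $ 1 * y $ 1)"
      using c[of k l] xy[of l] by (metis norm_mult)
    then show ?thesis
      using True unfolding twirl_def vector_scaleR_component A_mat_1_nth
      by (simp add: prod_state_nth scaleR_conv_of_real complex_norm_square[symmetric] del: complex_cnj_mult)
  next
    case False
    then show ?thesis
      using xy[of k] xy[of k'] unfolding twirl_def vector_scaleR_component A_mat_1_nth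
      by (auto simp: prod_state_nth scaleR_conv_of_real complex_norm_square
          simp del: complex_cnj_mult of_real_power)
  qed
  then show ?thesis by (simp only: vec_eq_iff split_paired_All) blast
qed

text \<open>The twirl of a two-level vector on levels \<open>i\<close>, \<open>j\<close> normalised
  by \<open>x $ i * y $ i = 1\<close>. The entries \<open>t\<close> and \<open>1 / t\<close> are the
  squared moduli of \<open>x $ i * y $ j\<close> and \<open>x $ j * y $ i\<close>.\<close>

definition pair_state :: "real \<Rightarrow> 3 \<Rightarrow> 3 \<Rightarrow> M33" where
  "pair_state t i j = (\<chi> p q.
     if p = q then
       (if p = (i, i) \<or> p = (j, j) then 1 else if p = (i, j) then of_real t
        else if p = (j, i) then of_real (1 / t) else 0)
     else if p = (i, i) \<and> q = (j, j) \<or> p = (j, j) \<and> q = (i, i) then 1 else 0)"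

lemma pair_state_diag:
  "pair_state t i j $ p $ p =
     of_real (if p = (i, i) \<or> p = (j, j) then 1 else if p = (i, j) then t else if p = (j, i) then 1 / t else 0)"
  by (simp add: pair_state_def)

definition two_level_pair :: "real \<Rightarrow> 3 \<Rightarrow> 3 \<Rightarrow> complex ^ 3 \<Rightarrow> complex ^ 3 \<Rightarrow> bool" where
  "two_level_pair t i j x y \<longleftrightarrow> i \<noteq> j \<and> (\<forall>k. k \<noteq> i \<and> k \<noteq> j \<longrightarrow> x $ k = 0 \<and> y $ k = 0) \<and>
     x $ i * y $ i = x $ j * y $ j \<and> (cmod (x $ i))\<^sup>2 = t * (cmod (x $ j))\<^sup>2"

lemma twirl_two_level_pair:
  assumes xy: "two_level_pair t i j x y" and t: "t > 0"
  shows "twirl x y = (cmod (x $ i * y $ i))\<^sup>2 *\<^sub>R pair_state t i j"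
proof -
  have ij: "i \<noteq> j" "j \<noteq> i" and zero: "\<And>k. k \<noteq> i \<Longrightarrow> k \<noteq> j \<Longrightarrow> x $ k = 0 \<and> y $ k = 0"
    and z: "x $ i * y $ i = x $ j * y $ j" and n: "(cmod (x $ i))\<^sup>2 = t * (cmod (x $ j))\<^sup>2"
    using xy unfolding two_level_pair_def by auto
  define c where "c = x $ i * y $ i"
  have c: "x $ i * y $ i = c" "x $ j * y $ j = c" using z unfolding c_def by auto
  have diag: "twirl x y $ (k, l) $ (k, l) = of_real ((cmod (x $ k))\<^sup>2 * (cmod (y $ l))\<^sup>2)" for k l
    by (simp add: twirl_def prod_state_nth complex_norm_square mult_ac del: of_real_power)
  have cc: "(cmod (x $ i))\<^sup>2 * (cmod (y $ i))\<^sup>2 = (cmod c)\<^sup>2" "(cmod (x $ j))\<^sup>2 * (cmod (y $ j))\<^sup>2 = (cmod c)\<^sup>2"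
    using c by (metis norm_mult power_mult_distrib)+
  have ij': "(cmod (x $ i))\<^sup>2 * (cmod (y $ j))\<^sup>2 = (cmod c)\<^sup>2 * t"
    using cc(2) n by (simp add: algebra_simps)
  have ji: "(cmod (x $ j))\<^sup>2 * (cmod (y $ i))\<^sup>2 = (cmod c)\<^sup>2 * (1 / t)"
    using cc(1) n t by (simp add: field_simps)
  have "twirl x y $ (k, l) $ (k', l') = ((cmod c)\<^sup>2 *\<^sub>R pair_state t i j) $ (k, l) $ (k', l')"
    for k l k' l'
  proof (cases "(k, l) = (k', l')")
    case True
    define e where "e = (if (k, l) = (i, i) \<or> (k, l) = (j, j) then 1 else if (k, l) = (i, j) then t
        else if (k, l) = (j, i) then 1 / t else 0)"
    have "(cmod (x $ k))\<^sup>2 * (cmod (y $ l))\<^sup>2 = (cmod c)\<^sup>2 * e"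
      using cc ij' ji zero[of k] zero[of l] ij unfolding e_def by auto
    then have "twirl x y $ (k, l) $ (k, l) = of_real ((cmod c)\<^sup>2 * e)"
      unfolding diag by (simp only:)
    moreover have "pair_state t i j $ (k, l) $ (k, l) = of_real e"
      unfolding e_def by (rule pair_state_diag)
    ultimately show ?thesis
      using True unfolding vector_scaleR_component by (simp add: scaleR_conv_of_real)
  next
    case False
    show ?thesis
    proof (cases "k = l \<and> k' = l'")
      case True
      then have "twirl x y $ (k, l) $ (k', l') = (x $ k * y $ k) * cnj (x $ k' * y $ k')"
        by (simp add: twirl_def prod_state_nth)
      then show ?thesis
        using False True c zero[of k] zero[of k'] ij unfolding vector_scaleR_component
        by (auto simp: pair_state_def scaleR_conv_of_real complex_norm_square
            simp del: complex_cnj_mult of_real_power)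
    next
      case nd: False
      then show ?thesis using False ij by (auto simp: twirl_def pair_state_def)
    qed
  qed
  then show ?thesis unfolding c_def by (simp only: vec_eq_iff split_paired_All) blast
qed

lemma pair_state_in_V1:
  assumes "t > 0" "i \<noteq> j"
  shows "pair_state t i j \<in> V1"
proof -
  define x y :: "complex ^ 3" where "x = (\<chi> k. if k = i then of_real (sqrt t) else if k = j then 1 else 0)"
    and "y = (\<chi> k. if k = i then of_real (1 / sqrt t) else if k = j then 1 else 0)"
  have "two_level_pair t i j x y"
    using assms by (auto simp: two_level_pair_def x_def y_def)
  moreover have "x $ i * y $ i = 1" using assms by (simp add: x_def y_def)
  ultimately have "twirl x y = pair_state t i j"
    using twirl_two_level_pair[of t i j x y] assms by simp
  then show ?thesis using twirl_in_V1 by metis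
qed

lemma A_mat_1_in_V1: "A_mat (1, 1, 1) \<in> V1"
proof -
  have "circular_pair 1 1" by (simp add: circular_pair_def)
  then show ?thesis using twirl_circular_pair[of 1 1] twirl_in_V1[of 1 1] by simp
qed

text \<open>Each level belongs to two of the three cyclic pairs, whence the diagonal entry 2; every
  other nonzero entry comes from exactly one pair.\<close>

lemma A_mat_eq_pair_states:
  "A_mat (2, b, 1 / b) = pair_state (1 / b) 1 2 + pair_state (1 / b) 2 3 + pair_state (1 / b) 3 1"
  unfolding vec_eq_iff split_paired_All forall_3 by (simp add: pair_state_def A_mat_nth index_3_distinct)

lemma A_mat_pair_in_V1: "b > 0 \<Longrightarrow> A_mat (2, b, 1 / b) \<in> V1"
  unfolding A_mat_eq_pair_states by (intro V1_add pair_state_in_V1) auto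

lemma pair_state_in_V1_face:
  assumes "b > 0" "(i, j) \<in> {(1, 2), (2, 3), (3, 1)}"
  shows "pair_state (1 / b) i j \<in> V1_face (A_mat (2, b, 1 / b))"
proof (rule V1_face_of_scaled_summand[where c = 1])
  let ?S = "\<lambda>i j. pair_state (1 / b) i j"
  let ?P = "if i = 1 then ?S 2 3 + ?S 3 1 else if i = 2 then ?S 1 2 + ?S 3 1 else ?S 1 2 + ?S 2 3"
  have V: "?S 1 2 \<in> V1" "?S 2 3 \<in> V1" "?S 3 1 \<in> V1" using assms(1) by (auto intro: pair_state_in_V1)
  then show "?P \<in> V1" by (auto intro: V1_add)
  show "?S i j \<in> V1" using V assms(2) by auto
  show "1 *\<^sub>R A_mat (2, b, 1 / b) = ?S i j + ?P"
    using assms(2) unfolding A_mat_eq_pair_states by (auto simp: algebra_simps)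
qed (use assms A_mat_pair_in_V1 in auto)

subsection \<open>Product vectors annihilated by \<open>\<Phi>(t)\<close>\<close>

lemma choi_matrix_nth: "choi_matrix \<phi> $ (i, k) $ (j, l) = \<phi> (mat_unit i j) $ k $ l"
proof -
  have "choi_matrix \<phi> $ (i, k) $ (j, l) =
      (\<Sum>i'\<in>UNIV. \<Sum>j'\<in>UNIV. mat_unit i' j' $ i $ j * \<phi> (mat_unit i' j') $ k $ l)"
    by (simp add: choi_matrix_def tensor_mat_def sum_component)
  also have "\<dots> =
      (\<Sum>i'\<in>UNIV. \<Sum>j'\<in>UNIV. (if j' = j then if i' = i then \<phi> (mat_unit i' j') $ k $ l else 0 else 0))"
    by (intro sum.cong refl) (simp add: mat_unit_def[of _ _])
  also have "\<dots> = \<phi> (mat_unit i j) $ k $ l"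
    by (simp add: sum.delta)
  finally show ?thesis .
qed

lemma pairing_eq_sum: "pairing B \<phi> = (\<Sum>p\<in>UNIV. \<Sum>q\<in>UNIV. choi_matrix \<phi> $ p $ q * B $ p $ q)"
  by (simp add: pairing_def trace_def matrix_matrix_mult_def transpose_def)

lemma linear_Re_pairing: "linear (\<lambda>B. Re (pairing B \<phi>))"
  by (rule linearI)
    (simp_all add: pairing_eq_sum distrib_left sum.distrib sum_distrib_left mult.left_commute)

lemma Phi_abc_nth:
  "Phi_abc \<alpha> \<beta> \<gamma> X $ 1 $ 1 = of_real \<alpha> * X $ 1 $ 1 + of_real \<beta> * X $ 2 $ 2 + of_real \<gamma> * X $ 3 $ 3"
  "Phi_abc \<alpha> \<beta> \<gamma> X $ 2 $ 2 = of_real \<gamma> * X $ 1 $ 1 + of_real \<alpha> * X $ 2 $ 2 + of_real \<beta> * X $ 3 $ 3"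
  "Phi_abc \<alpha> \<beta> \<gamma> X $ 3 $ 3 = of_real \<beta> * X $ 1 $ 1 + of_real \<gamma> * X $ 2 $ 2 + of_real \<alpha> * X $ 3 $ 3"
  "Phi_abc \<alpha> \<beta> \<gamma> X $ 1 $ 2 = - X $ 1 $ 2" "Phi_abc \<alpha> \<beta> \<gamma> X $ 1 $ 3 = - X $ 1 $ 3"
  "Phi_abc \<alpha> \<beta> \<gamma> X $ 2 $ 1 = - X $ 2 $ 1" "Phi_abc \<alpha> \<beta> \<gamma> X $ 2 $ 3 = - X $ 2 $ 3"
  "Phi_abc \<alpha> \<beta> \<gamma> X $ 3 $ 1 = - X $ 3 $ 1" "Phi_abc \<alpha> \<beta> \<gamma> X $ 3 $ 2 = - X $ 3 $ 2"
  unfolding Phi_abc_def by (simp_all only: vector_3)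

lemma Phi_abc_mat_unit:
  "Phi_abc \<alpha> \<beta> \<gamma> (mat_unit i j) $ k $ l =
     (if i = j \<and> k = l then
        of_real (if k = i then \<alpha> else if (i, k) \<in> {(1, 2), (2, 3), (3, 1)} then \<gamma> else \<beta>)
      else if k = i \<and> l = j then -1 else 0)"
proof -
  have "\<forall>i j k l. Phi_abc \<alpha> \<beta> \<gamma> (mat_unit i j) $ k $ l =
     (if i = j \<and> k = l then
        of_real (if k = i then \<alpha> else if (i, k) \<in> {(1, 2), (2, 3), (3, 1)} then \<gamma> else \<beta>)
      else if k = i \<and> l = j then -1 else 0)"
    unfolding forall_3 by (simp add: Phi_abc_nth mat_unit_def index_3_distinct)
  then show ?thesis by blast
qed

lemma pairing_Phi_abc:
  "pairing B (Phi_abc \<alpha> \<beta> \<gamma>) =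
     of_real \<alpha> * (B $ (1,1) $ (1,1) + B $ (2,2) $ (2,2) + B $ (3,3) $ (3,3))
   + of_real \<beta> * (B $ (1,3) $ (1,3) + B $ (2,1) $ (2,1) + B $ (3,2) $ (3,2))
   + of_real \<gamma> * (B $ (1,2) $ (1,2) + B $ (2,3) $ (2,3) + B $ (3,1) $ (3,1))
   - (B $ (1,1) $ (2,2) + B $ (2,2) $ (1,1) + B $ (2,2) $ (3,3) + B $ (3,3) $ (2,2)
      + B $ (3,3) $ (1,1) + B $ (1,1) $ (3,3))"
  unfolding pairing_eq_sum sum_3_times_3 sum_3 choi_matrix_nth Phi_abc_mat_unit
  by (simp add: index_3_distinct algebra_simps)

lemma Re_pairing_Phi_abc:
  "Re (pairing B (Phi_abc \<alpha> \<beta> \<gamma>)) =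
     \<alpha> * (Re (B $ (1,1) $ (1,1)) + Re (B $ (2,2) $ (2,2)) + Re (B $ (3,3) $ (3,3)))
   + \<beta> * (Re (B $ (1,3) $ (1,3)) + Re (B $ (2,1) $ (2,1)) + Re (B $ (3,2) $ (3,2)))
   + \<gamma> * (Re (B $ (1,2) $ (1,2)) + Re (B $ (2,3) $ (2,3)) + Re (B $ (3,1) $ (3,1)))
   - (Re (B $ (1,1) $ (2,2)) + Re (B $ (2,2) $ (1,1)) + Re (B $ (2,2) $ (3,3)) + Re (B $ (3,3) $ (2,2))
      + Re (B $ (3,3) $ (1,1)) + Re (B $ (1,1) $ (3,3)))"
  unfolding pairing_Phi_abc by simp

text \<open>\<open>dual_face\<close> asks for a vanishing complex number, whereas the face criterion
  uses real functionals; on hermitian matrices the two agree.\<close>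

lemma Im_pairing_Phi:
  assumes "B \<in> V1"
  shows "Im (pairing B (Phi t)) = 0"
proof -
  have "\<And>p q. B $ q $ p = cnj (B $ p $ q)"
    using V1_pos_semidef[OF assms] unfolding pos_semidef_def by blast
  then have im: "Im (B $ q $ p) = - Im (B $ p $ q)" for p q
    by (metis cnj.sel(2))
  have "Im (B $ p $ p) = 0" for p using im[of p p] by simp
  then show ?thesis
    unfolding Phi_def pairing_Phi_abc
    using im[of "(1,1)" "(2,2)"] im[of "(2,2)" "(3,3)"] im[of "(3,3)" "(1,1)"] by simp
qed

text \<open>Separates moduli from phases: the first summand depends on moduli only, and each of the
  other three brackets is nonnegative and measures how far two of the \<open>z\<close> are from
  having the same phase. The factor in front clears the denominators of \<open>Phi\<close>.\<close>

lemma Re_pairing_prod_state: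
  fixes x y :: "complex ^ 3" and t :: real
  defines "z \<equiv> \<lambda>k. x $ k * y $ k"
  shows "(1 - t + t\<^sup>2) * Re (pairing (prod_state x y) (Phi t)) =
     choi_form t (cmod (x $ 1)) (cmod (x $ 2)) (cmod (x $ 3)) (cmod (y $ 1)) (cmod (y $ 2)) (cmod (y $ 3))
   + 2 * (1 - t + t\<^sup>2) * ((cmod (z 1) * cmod (z 2) - Re (z 1 * cnj (z 2)))
      + (cmod (z 2) * cmod (z 3) - Re (z 2 * cnj (z 3))) + (cmod (z 3) * cmod (z 1) - Re (z 3 * cnj (z 1))))"
proof -
  define D where "D = 1 - t + t\<^sup>2"
  have D: "D > 0" unfolding D_def by (rule one_minus_plus_square_pos)
  have diag: "prod_state x y $ (k, l) $ (k, l) = of_real ((cmod (x $ k))\<^sup>2 * (cmod (y $ l))\<^sup>2)" for k l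
    by (simp add: prod_state_nth complex_norm_square mult_ac del: of_real_power)
  have off: "prod_state x y $ (k, k) $ (l, l) = z k * cnj (z l)" for k l
    by (simp add: prod_state_nth z_def)
  define a b where "a k = (cmod (x $ k))\<^sup>2" and "b k = (cmod (y $ k))\<^sup>2" for k
  define r where "r k l = Re (z k * cnj (z l))" for k l
  have Re_diag: "Re (prod_state x y $ (k, l) $ (k, l)) = a k * b l" for k l
    unfolding diag a_def b_def by (rule Re_complex_of_real)
  have Re_off: "Re (prod_state x y $ (k, k) $ (l, l)) = r k l" for k l
    unfolding off r_def ..
  have sym: "r l k = r k l" for k l
    unfolding r_def by (simp add: mult.commute)
  have "D * Re (pairing (prod_state x y) (Phi t)) =
      (1 - t)\<^sup>2 * (a 1 * b 1 + a 2 * b 2 + a 3 * b 3) + t\<^sup>2 * (a 1 * b 3 + a 2 * b 1 + a 3 * b 2)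
    + (a 1 * b 2 + a 2 * b 3 + a 3 * b 1) - D * (2 * r 1 2 + 2 * r 2 3 + 2 * r 3 1)"
    unfolding Phi_def D_def[symmetric] Re_pairing_Phi_abc Re_diag Re_off sym[of 2 1] sym[of 3 2] sym[of 1 3]
    using D by (simp add: field_simps)
  moreover have "cmod (z k) = cmod (x $ k) * cmod (y $ k)" for k
    by (simp add: z_def norm_mult)
  ultimately show ?thesis
    unfolding D_def[symmetric] r_def[symmetric] choi_form_def a_def b_def by (simp add: algebra_simps)
qed

lemma Re_mult_cnj_le: "Re (z * cnj w) \<le> cmod z * cmod w"
  using complex_Re_le_cmod[of "z * cnj w"] by (simp add: norm_mult)

lemma Re_pairing_Phi_nonneg:
  assumes "t > 0" "t \<noteq> 1"
  shows "0 \<le> Re (pairing (prod_state x y) (Phi t))"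
proof -
  define D where "D = 1 - t + t\<^sup>2"
  have D: "D > 0" unfolding D_def by (rule one_minus_plus_square_pos)
  have "0 \<le> D * Re (pairing (prod_state x y) (Phi t))"
    unfolding D_def Re_pairing_prod_state unfolding D_def[symmetric] using D
    by (intro add_nonneg_nonneg mult_nonneg_nonneg choi_form_nonneg assms)
      (simp_all add: Re_mult_cnj_le del: times_complex.sel complex_cnj_mult)
  then show ?thesis using D by (simp add: zero_le_mult_iff)
qed

lemma eq_if_Re_mult_cnj_eq:
  assumes "cmod z = cmod w" "Re (z * cnj w) = cmod z * cmod w"
  shows "z = w"
proof -
  have "(cmod (z - w))\<^sup>2 = (cmod z)\<^sup>2 + (cmod w)\<^sup>2 - 2 * Re (z * cnj w)"
    unfolding cmod_power2 by (simp add: power2_eq_square algebra_simps)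
  also have "\<dots> = 0" unfolding assms by (simp add: power2_eq_square)
  finally show ?thesis by simp
qed

text \<open>Both nonnegative parts of the preceding formula must vanish. The zeros of
  \<open>choi_form\<close> determine the moduli, and the vanishing of \<open>d\<close> aligns the
  phases, so equal moduli of the \<open>z\<close> become equalities.\<close>

lemma Re_pairing_Phi_zero_cases:
  assumes t: "t > 0" "t \<noteq> 1" and "Re (pairing (prod_state x y) (Phi t)) = 0"
  obtains "prod_state x y = 0" | "circular_pair x y"
  | i j where "(i, j) \<in> {(1, 2), (2, 3), (3, 1)}" "two_level_pair t i j x y"
proof -
  define z where "z = (\<lambda>k. x $ k * y $ k)"
  define D where "D = 1 - t + t\<^sup>2"
  have D: "D > 0" unfolding D_def by (rule one_minus_plus_square_pos)
  define d where "d k l = cmod (z k) * cmod (z l) - Re (z k * cnj (z l))" for k l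
  have d: "d k l \<ge> 0" for k l unfolding d_def using Re_mult_cnj_le by simp
  let ?f = "choi_form t (cmod (x $ 1)) (cmod (x $ 2)) (cmod (x $ 3)) (cmod (y $ 1)) (cmod (y $ 2)) (cmod (y $ 3))"
  have "?f + 2 * D * (d 1 2 + d 2 3 + d 3 1) = 0"
    using Re_pairing_prod_state[of t x y] assms(3) unfolding D_def d_def z_def by simp
  moreover have "?f \<ge> 0" by (rule choi_form_nonneg[OF t]) simp_all
  moreover have "2 * D * (d 1 2 + d 2 3 + d 3 1) \<ge> 0" using D d by simp
  ultimately have f: "?f = 0" and "2 * D * (d 1 2 + d 2 3 + d 3 1) = 0" by linarith+
  then have "d 1 2 + d 2 3 + d 3 1 = 0" using D by simp
  then have d0: "d 1 2 = 0" "d 2 3 = 0" "d 3 1 = 0" using d[of 1 2] d[of 2 3] d[of 3 1] by linarith+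
  have eqz: "z k = z l" if "d k l = 0" "cmod (z k) = cmod (z l)" for k l
    using eq_if_Re_mult_cnj_eq[of "z k" "z l"] that unfolding d_def by simp
  have pair: "two_level_pair t i j x y"
    if "i \<noteq> j" "\<forall>k. k \<noteq> i \<and> k \<noteq> j \<longrightarrow> x $ k = 0 \<and> y $ k = 0" "d i j = 0"
      "(cmod (x $ i))\<^sup>2 = t * (cmod (x $ j))\<^sup>2" "(cmod (y $ j))\<^sup>2 = t * (cmod (y $ i))\<^sup>2" for i j
  proof -
    \<comment> \<open>The two factors \<open>t\<close>, one from \<open>x\<close> and one from
      \<open>y\<close>, balance each other.\<close>
    have "(cmod (z i))\<^sup>2 = (cmod (z j))\<^sup>2"
      unfolding z_def norm_mult power_mult_distrib that(4,5) by simp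
    then have "cmod (z i) = cmod (z j)" by simp
    then show ?thesis using eqz[OF that(3)] that unfolding two_level_pair_def z_def by simp
  qed
  from f show thesis
  proof (rule choi_form_zero_cases[OF t norm_ge_zero norm_ge_zero norm_ge_zero], goal_cases)
    case 1
    then have "prod_state x y = 0" by (simp add: vec_eq_iff prod_state_nth split_paired_All forall_3)
    then show ?case by (rule that(1))
  next
    case 2
    then have "prod_state x y = 0" by (simp add: vec_eq_iff prod_state_nth split_paired_All forall_3)
    then show ?case by (rule that(1))
  next
    case 3
    then have "cmod (z 1) = cmod (z 2)" "cmod (z 2) = cmod (z 3)" by (simp_all add: z_def norm_mult)
    then have "z 1 = z 2" "z 2 = z 3" using eqz d0 by blast+
    then have "circular_pair x y"
      using 3 unfolding circular_pair_def forall_3 z_def by simp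
    then show ?case by (rule that(2))
  next
    case 4
    then have "two_level_pair t 1 2 x y" using d0 by (intro pair) (simp_all add: forall_3)
    then show ?case using that(3) by blast
  next
    case 5
    then have "two_level_pair t 2 3 x y" using d0 by (intro pair) (simp_all add: forall_3)
    then show ?case using that(3) by blast
  next
    case 6
    then have "two_level_pair t 3 1 x y" using d0 by (intro pair) (simp_all add: forall_3)
    then show ?case using that(3) by blast
  qed
qed

lemma dual_face_Phi: "dual_face (Phi t) = {B \<in> V1. \<forall>L\<in>{\<lambda>B. Re (pairing B (Phi t))}. L B = 0}"
  unfolding dual_face_def using Im_pairing_Phi by (auto simp: complex_eq_iff)

lemma Re_pairing_A_mat:
  "Re (pairing (A_mat (a, b, c)) (Phi_abc \<alpha> \<beta> \<gamma>)) = 3 * (\<alpha> * a + \<beta> * b + \<gamma> * c) - 6"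
  unfolding pairing_Phi_abc by (simp add: A_mat_nth algebra_simps)

lemma Re_pairing_Phi_A_mat_1: "Re (pairing (A_mat (1, 1, 1)) (Phi t)) = 0"
proof -
  have "(1 - t)\<^sup>2 / D + t\<^sup>2 / D + 1 / D = 2" if "D > 0" "D = 1 - t + t\<^sup>2" for D
    using that(1) by (simp add: field_simps) (simp add: that(2) power2_eq_square algebra_simps)
  from this[OF one_minus_plus_square_pos[of t] refl] show ?thesis
    unfolding Phi_def Re_pairing_A_mat by simp
qed

lemma Re_pairing_Phi_A_mat_pair:
  assumes "b > 0"
  shows "Re (pairing (A_mat (2, b, 1 / b)) (Phi (1 / b))) = 0"
proof -
  define t where "t = 1 / b"
  have t: "t > 0" "b = 1 / t" "1 / b = t" using assms by (auto simp: t_def)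
  have "(1 - t)\<^sup>2 / D * 2 + t\<^sup>2 / D * (1 / t) + 1 / D * t = 2" if "D > 0" "D = 1 - t + t\<^sup>2" for D
    using that(1) t(1) by (simp add: field_simps) (simp add: that(2) power2_eq_square algebra_simps)
  from this[OF one_minus_plus_square_pos[of t] refl] show ?thesis
    unfolding Phi_def Re_pairing_A_mat t(3) unfolding t(2) by simp
qed

subsection \<open>Ranges and faces of the matrices \<open>A[a,b,c]\<close>\<close>

lemma vdot_axis: "vdot (axis p a + axis q b) v = a * v $ p + b * v $ q"
  by (simp add: vdot_def axis_def distrib_right sum.distrib if_distrib[of "\<lambda>z. z * _"] cong: if_cong)

lemma mat_range_A_mat_1:
  "mat_range (A_mat (1, 1, 1)) =
    {v. \<forall>l\<in>{axis (1, 1) 1 + axis (2, 2) (-1), axis (1, 1) 1 + axis (3, 3) (-1)}. vdot l v = 0}"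
proof (intro equalityI subsetI)
  fix v :: "complex ^ (3 \<times> 3)"
  assume "v \<in> {v. \<forall>l\<in>{axis (1, 1) 1 + axis (2, 2) (-1), axis (1, 1) 1 + axis (3, 3) (-1)}. vdot l v = 0}"
  then have "v $ (2, 2) = v $ (1, 1)" "v $ (3, 3) = v $ (1, 1)"
    by (auto simp: vdot_axis)
  \<comment> \<open>The block on the indices \<open>(i, i)\<close> is the all-ones matrix, which
    maps three equal entries \<open>v / 3\<close> to \<open>v\<close>; elsewhere the matrix is the
    identity.\<close>
  then have "v = A_mat (1, 1, 1) *v (\<chi> p. if fst p = snd p then v $ p / 3 else v $ p)"
    by (simp add: vec_eq_iff split_paired_All forall_3 matrix_vector_mult_def
        sum_3_times_3 sum_3 A_mat_1_nth index_3_distinct)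
  then show "v \<in> mat_range (A_mat (1, 1, 1))" unfolding mat_range_def by blast
qed (auto simp: mat_range_def vdot_axis matrix_vector_mult_def
    sum_3_times_3 sum_3 A_mat_1_nth index_3_distinct)

lemma mat_range_A_mat_pair:
  assumes "b > 0"
  shows "mat_range (A_mat (2, b, 1 / b)) = {v. \<forall>l\<in>{}. vdot l v = 0}"
proof -
  \<comment> \<open>An explicit inverse. On the indices \<open>(i, i)\<close> the block is
    \<open>I + J\<close> with \<open>J\<close> the all-ones matrix, and \<open>J * J = 3 * J\<close>
    gives the inverse \<open>I - J / 4\<close>.\<close>
  have "v = A_mat (2, b, 1 / b) *v (\<chi> p. if fst p = snd p then v $ p - (v $ (1,1) + v $ (2,2) + v $ (3,3)) / 4
      else if p = (2, 1) \<or> p = (3, 2) \<or> p = (1, 3) then v $ p / of_real b else of_real b * v $ p)" for v :: "complex ^ (3 \<times> 3)"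
    using assms
    by (simp add: vec_eq_iff split_paired_All forall_3 matrix_vector_mult_def
        sum_3_times_3 sum_3 A_mat_nth index_3_distinct) (simp add: field_simps)
  then show ?thesis unfolding mat_range_def by auto
qed

text \<open>Apart from the entries \<open>a\<close>, the partial transpose consists of three blocks
  with diagonal \<open>b\<close>, \<open>1 / b\<close> and off-diagonal entries 1. Each has
  determinant 0 and range spanned by \<open>(b, 1)\<close>, giving one equation per block.\<close>

lemma mat_range_partial_transpose_A_mat:
  assumes "a > 0" "b > 0"
  shows "mat_range (partial_transpose (A_mat (a, b, 1 / b))) =
    {v. \<forall>l\<in>{axis (2, 1) 1 + axis (1, 2) (- of_real b), axis (3, 2) 1 + axis (2, 3) (- of_real b),
            axis (1, 3) 1 + axis (3, 1) (- of_real b)}. vdot l v = 0}"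
    (is "_ = ?R")
proof (intro equalityI subsetI)
  fix v
  assume "v \<in> ?R"
  then have "v = partial_transpose (A_mat (a, b, 1 / b)) *v (\<chi> p. if fst p = snd p then v $ p / of_real a
      else if p = (2, 1) then v $ (1, 2) else if p = (3, 2) then v $ (2, 3)
      else if p = (1, 3) then v $ (3, 1) else 0)"
    using assms
    by (simp add: vdot_axis vec_eq_iff split_paired_All forall_3 matrix_vector_mult_def
        sum_3_times_3 sum_3 A_mat_nth index_3_distinct partial_transpose_def)
  then show "v \<in> mat_range (partial_transpose (A_mat (a, b, 1 / b)))" unfolding mat_range_def by blast
next
  fix v
  assume "v \<in> mat_range (partial_transpose (A_mat (a, b, 1 / b)))"
  then show "v \<in> ?R"
    using assms by (auto simp: mat_range_def vdot_axis matrix_vector_mult_def field_simps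
        sum_3_times_3 sum_3 A_mat_nth index_3_distinct partial_transpose_def)
qed


section \<open>The faces of the end points and of interior points of the segment\<close>

lemma vdot_tensor_axis:
  "vdot (axis (i, k) a + axis (j, l) b) (tensor_vec x y) = a * (x $ i * y $ k) + b * (x $ j * y $ l)"
  unfolding vdot_axis by (simp add: tensor_vec_def)

lemma quad_partial_transpose_prod_state_eq_0:
  "quad l (partial_transpose (prod_state x y)) = 0 \<longleftrightarrow> vdot l (tensor_vec (\<chi> i. cnj (x $ i)) y) = 0"
  unfolding partial_transpose_prod_state unfolding prod_state_def quad_rank_one by simp

lemma quad_eq_0_if_range:
  assumes "B \<in> V1" "mat_range B = {v. \<forall>l\<in>\<Lambda>. vdot l v = 0}" "l \<in> \<Lambda>"
  shows "quad l B = 0"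
  unfolding vdot_range_eq_0_iff[OF assms(1), symmetric] using assms(2,3) unfolding mat_range_def by blast

text \<open>The assumptions \<open>xy\<close> say that \<open>y\<close> and the conjugate of
  \<open>x\<close> are parallel. If the common product \<open>c\<close> is nonzero, multiplying by
  \<open>x $ k * x $ l\<close> and cancelling \<open>c\<close> equates the moduli; if
  \<open>c = 0\<close>, parallelism forces one of the vectors to vanish.\<close>

lemma circular_pair_if:
  assumes x: "x $ 1 * y $ 1 = x $ 2 * y $ 2" "x $ 1 * y $ 1 = x $ 3 * y $ 3"
    and xy: "cnj (x $ 2) * y $ 1 = cnj (x $ 1) * y $ 2" "cnj (x $ 3) * y $ 2 = cnj (x $ 2) * y $ 3"
      "cnj (x $ 1) * y $ 3 = cnj (x $ 3) * y $ 1"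
  shows "prod_state x y = 0 \<or> circular_pair x y"
proof -
  define c where "c = x $ 1 * y $ 1"
  have c: "x $ k * y $ k = c" for k
    using x exhaust_3[of k] unfolding c_def by auto
  have xy': "cnj (x $ k) * y $ l = cnj (x $ l) * y $ k" for k l
    using xy exhaust_3[of k] exhaust_3[of l] by auto
  show ?thesis
  proof (cases "c = 0")
    case False
    have "cmod (x $ k) = cmod (x $ l)" for k l
    proof -
      have "(x $ k * cnj (x $ k)) * (x $ l * y $ l) = (x $ l * cnj (x $ l)) * (x $ k * y $ k)"
        using xy'[of k l] by (simp add: algebra_simps)
      then have "x $ k * cnj (x $ k) = x $ l * cnj (x $ l)" using c False by simp
      then show ?thesis by (metis complex_norm_square norm_ge_zero of_real_eq_iff power2_eq_imp_eq)
    qed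
    then show ?thesis using c unfolding circular_pair_def by metis
  next
    case True
    have "x = 0 \<or> y = 0"
    proof (rule disjCI)
      assume "y \<noteq> 0"
      then obtain j where j: "y $ j \<noteq> 0" by (auto simp: vec_eq_iff)
      then have "x $ j = 0" using c[of j] True by simp
      then have "x $ k = 0" for k using xy'[of k j] j by simp
      then show "x = 0" by (simp add: vec_eq_iff)
    qed
    then show ?thesis by (auto simp: vec_eq_iff prod_state_nth)
  qed
qed

text \<open>The range conditions for the matrix and its partial transpose leave only circular
  vectors, and their twirls are multiples of \<open>A_mat (1, 1, 1)\<close>.\<close>

lemma V1_face_A_mat_1: "V1_face (A_mat (1, 1, 1)) = V1 \<inter> PPT_face (A_mat (1, 1, 1))"
proof -
  let ?A = "A_mat (1, 1, 1)"
  define \<Lambda> \<Lambda>' :: "(complex ^ (3 \<times> 3)) set"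
    where "\<Lambda> = {axis (1, 1) 1 + axis (2, 2) (-1), axis (1, 1) 1 + axis (3, 3) (-1)}"
      and "\<Lambda>' = {axis (2, 1) 1 + axis (1, 2) (-1), axis (3, 2) 1 + axis (2, 3) (-1),
            axis (1, 3) 1 + axis (3, 1) (-1)}"
  have R: "mat_range ?A = {v. \<forall>l\<in>\<Lambda>. vdot l v = 0}"
    unfolding \<Lambda>_def by (rule mat_range_A_mat_1)
  have R': "mat_range (partial_transpose ?A) = {v. \<forall>l\<in>\<Lambda>'. vdot l v = 0}"
    unfolding \<Lambda>'_def using mat_range_partial_transpose_A_mat[of 1 1] by simp
  show ?thesis
    unfolding V1_Int_PPT_face[OF R R']
  proof (rule V1_face_eq_zeros[OF A_mat_1_in_V1])
    fix L assume L: "L \<in> quad ` \<Lambda> \<union> (\<lambda>l B. quad l (partial_transpose B)) ` \<Lambda>'"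
    show "L ?A = 0"
      using L quad_eq_0_if_range[OF A_mat_1_in_V1 R] quad_eq_0_if_range[OF partial_transpose_V1[OF A_mat_1_in_V1] R']
      by auto
    show "linear L"
      using L linear_quad linear_compose[OF linear_partial_transpose linear_quad] by (auto simp: o_def)
    show "0 \<le> L (prod_state x y)" for x y
      using L quad_prod_state_nonneg by (auto simp: partial_transpose_prod_state)
  next
    fix x y
    assume 0: "\<And>L. L \<in> quad ` \<Lambda> \<union> (\<lambda>l B. quad l (partial_transpose B)) ` \<Lambda>' \<Longrightarrow> L (prod_state x y) = 0"
    have "quad l (prod_state x y) = 0" if "l \<in> \<Lambda>" for l using 0 that by blast
    then have "\<forall>l\<in>\<Lambda>. vdot l (tensor_vec x y) = 0"
      by (simp add: prod_state_def quad_rank_one)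
    moreover have "quad l (partial_transpose (prod_state x y)) = 0" if "l \<in> \<Lambda>'" for l
      using 0 that by blast
    then have "\<forall>l\<in>\<Lambda>'. vdot l (tensor_vec (\<chi> i. cnj (x $ i)) y) = 0"
      by (simp add: quad_partial_transpose_prod_state_eq_0)
    ultimately have "prod_state x y = 0 \<or> circular_pair x y"
      unfolding \<Lambda>_def \<Lambda>'_def by (intro circular_pair_if) (auto simp: vdot_tensor_axis)
    then show "prod_state x y \<in> V1_face ?A"
      using zero_in_V1_face[OF A_mat_1_in_V1]
        prod_state_in_V1_face[OF A_mat_1_in_V1 self_in_V1_face twirl_circular_pair, of x y] by auto
  qed
qed

lemma two_level_pair_in_V1_face:
  assumes "b > 0" "(i, j) \<in> {(1, 2), (2, 3), (3, 1)}" "two_level_pair (1 / b) i j x y"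
  shows "prod_state x y \<in> V1_face (A_mat (2, b, 1 / b))"
  using assms
  by (intro prod_state_in_V1_face[OF _ pair_state_in_V1_face twirl_two_level_pair])
    (auto intro: A_mat_pair_in_V1)

text \<open>The matrix itself has full range, so the functionals are the pairing with
  \<open>Phi\<close> and those of the partial transpose. Of the vectors annihilated by
  \<open>Phi\<close>, the two-level ones already lie in the face; it remains to exclude nonzero
  circular ones.\<close>

lemma V1_face_A_mat_pair:
  assumes b: "b > 0" "b \<noteq> 1"
  shows "V1_face (A_mat (2, b, 1 / b)) = dual_face (Phi (1 / b)) \<inter> PPT_face (A_mat (2, b, 1 / b))"
proof -
  let ?A = "A_mat (2, b, 1 / b)"
  have t: "1 / b > 0" "1 / b \<noteq> 1" using b by auto
  have A: "?A \<in> V1" using A_mat_pair_in_V1 b by blast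
  define \<Lambda>' :: "(complex ^ (3 \<times> 3)) set"
    where "\<Lambda>' = {axis (2, 1) 1 + axis (1, 2) (- of_real b), axis (3, 2) 1 + axis (2, 3) (- of_real b),
            axis (1, 3) 1 + axis (3, 1) (- of_real b)}"
  have R: "mat_range ?A = {v. \<forall>l\<in>{}. vdot l v = 0}"
    using mat_range_A_mat_pair b by blast
  have R': "mat_range (partial_transpose ?A) = {v. \<forall>l\<in>\<Lambda>'. vdot l v = 0}"
    unfolding \<Lambda>'_def using mat_range_partial_transpose_A_mat[of 2 b] b by simp
  let ?\<phi> = "\<lambda>B. Re (pairing B (Phi (1 / b)))"
  define \<L> where "\<L> = insert ?\<phi> ((\<lambda>l B. quad l (partial_transpose B)) ` \<Lambda>')"
  have "dual_face (Phi (1 / b)) \<inter> PPT_face ?A = dual_face (Phi (1 / b)) \<inter> (V1 \<inter> PPT_face ?A)"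
    unfolding dual_face_def by blast
  also have "\<dots> = {B \<in> V1. \<forall>L\<in>\<L>. L B = 0}"
    unfolding V1_Int_PPT_face[OF R R'] dual_face_Phi \<L>_def by auto
  also have "V1_face ?A = \<dots>"
  proof (rule V1_face_eq_zeros[OF A])
    fix L assume L: "L \<in> \<L>"
    show "L ?A = 0"
      using L quad_eq_0_if_range[OF partial_transpose_V1[OF A] R'] Re_pairing_Phi_A_mat_pair[OF b(1)]
      unfolding \<L>_def by auto
    show "linear L"
      using L linear_Re_pairing linear_compose[OF linear_partial_transpose linear_quad]
      unfolding \<L>_def by (auto simp: o_def)
    show "0 \<le> L (prod_state x y)" for x y
      using L quad_prod_state_nonneg Re_pairing_Phi_nonneg[OF t] unfolding \<L>_def
      by (auto simp: partial_transpose_prod_state)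
  next
    fix x y
    assume 0: "\<And>L. L \<in> \<L> \<Longrightarrow> L (prod_state x y) = 0"
    have "vdot l (tensor_vec (\<chi> i. cnj (x $ i)) y) = 0" if "l \<in> \<Lambda>'" for l
      using 0[of "\<lambda>B. quad l (partial_transpose B)"] that unfolding \<L>_def
      by (simp add: quad_partial_transpose_prod_state_eq_0)
    from this[of "axis (2, 1) 1 + axis (1, 2) (- of_real b)"]
    have eq: "cnj (x $ 2) * y $ 1 = of_real b * (cnj (x $ 1) * y $ 2)"
      unfolding \<Lambda>'_def by (simp add: vdot_tensor_axis)
    have "?\<phi> (prod_state x y) = 0" using 0 unfolding \<L>_def by blast
    then show "prod_state x y \<in> V1_face ?A"
    proof (cases rule: Re_pairing_Phi_zero_cases[OF t, consumes 1])
      case 1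
      then show ?thesis using zero_in_V1_face[OF A] by simp
    next
      case 2
      have x: "cmod (x $ k) = cmod (x $ 1)" and xy: "x $ k * y $ k = x $ 1 * y $ 1" for k
        using 2 unfolding circular_pair_def by blast+
      have n: "cmod (x $ 1) * cmod (y $ k) = cmod (x $ 1) * cmod (y $ 1)" for k
        using xy[of k] x[of k] by (metis norm_mult)
      \<comment> \<open>The range equation asks for a ratio \<open>b\<close> where circularity asks
        for ratio 1; as \<open>b\<close> differs from 1, the product state is zero.\<close>
      have "cmod (x $ 1) * cmod (y $ 1) = b * (cmod (x $ 1) * cmod (y $ 2))"
        using arg_cong[OF eq, of cmod] x[of 2] b(1) by (simp add: norm_mult)
      then have "cmod (x $ 1) * cmod (y $ 1) = 0" using n[of 2] b(2) by auto
      then have "cmod (x $ k) * cmod (y $ l) = 0" for k l using n[of l] x[of k] by metis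
      then have "x $ k * y $ l = 0" for k l by simp
      then have "prod_state x y = 0" by (simp add: vec_eq_iff prod_state_nth)
      then show ?thesis using zero_in_V1_face[OF A] by simp
    next
      case (3 i j)
      then show ?thesis using two_level_pair_in_V1_face b(1) by blast
    qed
  qed
  finally show ?thesis by simp
qed

text \<open>\<open>A_mat\<close> is affine, not linear: the constant off-diagonal entries 1 are
  reproduced because the weights sum to 1.\<close>

lemma A_mat_segment:
  "A_mat ((1 - s) *\<^sub>R (1, 1, 1) + s *\<^sub>R (2, b, 1 / b)) =
     (1 - s) *\<^sub>R A_mat (1, 1, 1) + s *\<^sub>R A_mat (2, b, 1 / b)"
proof -
  have "(1 - s) *\<^sub>R (1, 1, 1) + s *\<^sub>R (2, b, 1 / b) =
      ((1 - s) + s * 2, (1 - s) + s * b, (1 - s) + s * (1 / b))"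
    by simp
  moreover have "A_mat ((1 - s) + s * 2, (1 - s) + s * b, (1 - s) + s * (1 / b)) $ p $ q =
      ((1 - s) *\<^sub>R A_mat (1, 1, 1) + s *\<^sub>R A_mat (2, b, 1 / b)) $ p $ q" for p q
    unfolding vector_add_component vector_scaleR_component A_mat_nth
    by (cases "p = q"; cases "fst p = snd p"; cases "p \<in> {(1, 2), (2, 3), (3, 1)}"; cases "fst q = snd q")
      (simp_all add: scaleR_conv_of_real del: insert_iff)
  ultimately show ?thesis by (simp only: vec_eq_iff) blast
qed

text \<open>Both end points are, up to scaling, summands of the interior point, so its face contains
  theirs. Every product state annihilated by \<open>Phi\<close> lies in one of these two faces,
  which gives the dual face and, by collecting summands, its decomposition.\<close>

lemma V1_face_segment:
  assumes b: "b > 0" "b \<noteq> 1" and s: "0 < s" "s < 1"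
    and e: "e = (1 - s) *\<^sub>R (1, 1, 1) + s *\<^sub>R (2, b, 1 / b)"
  shows "V1_face (A_mat e) = dual_face (Phi (1 / b))"
    and "V1_face (A_mat e) = convex hull (V1_face (A_mat (1, 1, 1)) \<union> V1_face (A_mat (2, b, 1 / b)))"
proof -
  let ?A = "A_mat e" and ?A1 = "A_mat (1, 1, 1)" and ?Ab = "A_mat (2, b, 1 / b)"
  let ?\<phi> = "\<lambda>B. Re (pairing B (Phi (1 / b)))"
  have t: "1 / b > 0" "1 / b \<noteq> 1" using b by auto
  have A1: "?A1 \<in> V1" by (rule A_mat_1_in_V1)
  have Ab: "?Ab \<in> V1" using b by (intro A_mat_pair_in_V1)
  have Ae: "?A = (1 - s) *\<^sub>R ?A1 + s *\<^sub>R ?Ab"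
    unfolding e by (rule A_mat_segment)
  have sA: "(1 - s) *\<^sub>R ?A1 \<in> V1" "s *\<^sub>R ?Ab \<in> V1"
    using s A1 Ab by (auto intro: convex_cone_scaleR[OF convex_cone_V1])
  have A: "?A \<in> V1" unfolding Ae using sA by (intro V1_add)
  have face: "V1_face ?A face_of V1" using A by (rule V1_face_face_of)
  have "(1 - s) *\<^sub>R ?A1 \<in> V1_face ?A" "s *\<^sub>R ?Ab \<in> V1_face ?A"
    using V1_face_of_scaled_summand[OF A, of 1, OF _ sA(1) sA(2)] V1_face_of_scaled_summand[OF A, of 1, OF _ sA(2) sA(1)] Ae
    by (simp_all add: add.commute)
  then have "(1 / (1 - s)) *\<^sub>R (1 - s) *\<^sub>R ?A1 \<in> V1_face ?A" "(1 / s) *\<^sub>R s *\<^sub>R ?Ab \<in> V1_face ?A"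
    using s by (auto intro!: face_of_convex_cone_scaleR[OF convex_cone_V1 face] simp del: scaleR_scaleR)
  then have "?A1 \<in> V1_face ?A" "?Ab \<in> V1_face ?A" using s by simp_all
  then have sub: "V1_face ?A1 \<subseteq> V1_face ?A" "V1_face ?Ab \<subseteq> V1_face ?A"
    using V1_face_mono[OF A] by blast+
  have gen: "prod_state x y \<in> V1_face ?A1 \<or> prod_state x y \<in> V1_face ?Ab"
    if "?\<phi> (prod_state x y) = 0" for x y
    using that
  proof (cases rule: Re_pairing_Phi_zero_cases[OF t, consumes 1])
    case 1
    then show ?thesis using zero_in_V1_face[OF A1] by simp
  next
    case 2
    then show ?thesis
      using prod_state_in_V1_face[OF A1 self_in_V1_face twirl_circular_pair, of x y] by simp
  next
    case (3 i j)
    then show ?thesis using two_level_pair_in_V1_face b(1) by blast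
  qed
  show eq: "V1_face ?A = dual_face (Phi (1 / b))"
    unfolding dual_face_Phi
  proof (rule V1_face_eq_zeros[OF A])
    fix L assume L: "L \<in> {?\<phi>}"
    then show lin: "linear L" using linear_Re_pairing by simp
    show "L ?A = 0"
      unfolding Ae using L Re_pairing_Phi_A_mat_1 Re_pairing_Phi_A_mat_pair[OF b(1)]
      by (simp add: linear_add[OF linear_Re_pairing] linear_scale[OF linear_Re_pairing])
    show "0 \<le> L (prod_state x y)" for x y using L Re_pairing_Phi_nonneg[OF t] by simp
  next
    fix x y
    assume "\<And>L. L \<in> {?\<phi>} \<Longrightarrow> L (prod_state x y) = 0"
    then show "prod_state x y \<in> V1_face ?A" using gen[of x y] sub by blast
  qed
  \<comment> \<open>The dual face is the sum of the two smaller cones.\<close>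
  have decomp: "?\<phi> B = 0 \<longrightarrow> (\<exists>P\<in>V1_face ?A1. \<exists>Q\<in>V1_face ?Ab. B = P + Q)" if "B \<in> V1" for B
    using that
  proof (induction B rule: V1_induct)
    case zero
    then show ?case using zero_in_V1_face[OF A1] zero_in_V1_face[OF Ab] by force
  next
    case (add B x y)
    show ?case
    proof
      assume "?\<phi> (B + prod_state x y) = 0"
      then have "?\<phi> B = 0" and xy: "?\<phi> (prod_state x y) = 0"
        using linear_nonneg_on_V1[OF linear_Re_pairing Re_pairing_Phi_nonneg[OF t] add.hyps]
          Re_pairing_Phi_nonneg[OF t, of x y] linear_add[OF linear_Re_pairing, of B "prod_state x y"]
        by (metis add_nonneg_eq_0_iff)+
      then obtain P Q where PQ: "P \<in> V1_face ?A1" "Q \<in> V1_face ?Ab" "B = P + Q"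
        using add.IH by blast
      note add_face = face_of_convex_cone_add[OF convex_cone_V1 V1_face_face_of]
      from gen[OF xy] show "\<exists>P\<in>V1_face ?A1. \<exists>Q\<in>V1_face ?Ab. B + prod_state x y = P + Q"
      proof
        assume "prod_state x y \<in> V1_face ?A1"
        then have "P + prod_state x y \<in> V1_face ?A1" using add_face[OF A1] PQ by blast
        moreover have "B + prod_state x y = (P + prod_state x y) + Q"
          unfolding PQ(3) by (simp only: ac_simps)
        ultimately show ?thesis using PQ(2) by blast
      next
        assume "prod_state x y \<in> V1_face ?Ab"
        then have "Q + prod_state x y \<in> V1_face ?Ab" using add_face[OF Ab] PQ by blast
        moreover have "B + prod_state x y = P + (Q + prod_state x y)"
          unfolding PQ(3) by (simp only: ac_simps)
        ultimately show ?thesis using PQ(1) by blast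
      qed
    qed
  qed
  show "V1_face ?A = convex hull (V1_face ?A1 \<union> V1_face ?Ab)"
  proof
    show "convex hull (V1_face ?A1 \<union> V1_face ?Ab) \<subseteq> V1_face ?A"
      using sub face_of_imp_convex[OF face] by (intro hull_minimal) auto
    show "V1_face ?A \<subseteq> convex hull (V1_face ?A1 \<union> V1_face ?Ab)"
    proof
      fix B assume "B \<in> V1_face ?A"
      then have "B \<in> V1" "?\<phi> B = 0"
        unfolding eq dual_face_Phi by simp_all
      then obtain P Q where PQ: "P \<in> V1_face ?A1" "Q \<in> V1_face ?Ab" "B = P + Q"
        using decomp by blast
      \<comment> \<open>Doubling turns the sum \<open>P + Q\<close> into a midpoint, hence a convex
        combination.\<close>
      have "2 *\<^sub>R P \<in> V1_face ?A1" "2 *\<^sub>R Q \<in> V1_face ?Ab"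
        using PQ face_of_convex_cone_scaleR[OF convex_cone_V1 V1_face_face_of] A1 Ab by auto
      then have "2 *\<^sub>R P \<in> convex hull (V1_face ?A1 \<union> V1_face ?Ab)"
        "2 *\<^sub>R Q \<in> convex hull (V1_face ?A1 \<union> V1_face ?Ab)"
        by (auto intro: hull_inc)
      then have "(1/2) *\<^sub>R (2 *\<^sub>R P) + (1/2) *\<^sub>R (2 *\<^sub>R Q) \<in> convex hull (V1_face ?A1 \<union> V1_face ?Ab)"
        by (intro convexD[OF convex_convex_hull]) auto
      then show "B \<in> convex hull (V1_face ?A1 \<union> V1_face ?Ab)" using PQ(3) by simp
    qed
  qed
qed

theorem theorem4p1:
  "V1_face (A_mat (1, 1, 1)) = V1 \<inter> PPT_face (A_mat (1, 1, 1)) \<and>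
   (\<forall>b::real. 0 < b \<and> b \<noteq> 1 \<longrightarrow>
      V1_face (A_mat (2, b, 1 / b)) = dual_face (Phi (1 / b)) \<inter> PPT_face (A_mat (2, b, 1 / b))) \<and>
   (\<forall>(b::real) s e. 0 < b \<and> b \<noteq> 1 \<and> 0 < s \<and> s < 1 \<and>
        e = (1 - s) *\<^sub>R (1, 1, 1) + s *\<^sub>R (2, b, 1 / b) \<longrightarrow>
      V1_face (A_mat e) = dual_face (Phi (1 / b)) \<and>
      V1_face (A_mat e) =
        convex hull (V1_face (A_mat (1, 1, 1)) \<union> V1_face (A_mat (2, b, 1 / b))))"
proof (intro conjI allI impI V1_face_A_mat_1)
  fix b :: real assume "0 < b \<and> b \<noteq> 1"
  then show "V1_face (A_mat (2, b, 1 / b)) = dual_face (Phi (1 / b)) \<inter> PPT_face (A_mat (2, b, 1 / b))"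
    using V1_face_A_mat_pair[of b] by simp
next
  fix b s :: real and e :: "real \<times> real \<times> real"
  assume "0 < b \<and> b \<noteq> 1 \<and> 0 < s \<and> s < 1 \<and> e = (1 - s) *\<^sub>R (1, 1, 1) + s *\<^sub>R (2, b, 1 / b)"
  then show "V1_face (A_mat e) = dual_face (Phi (1 / b))"
    "V1_face (A_mat e) = convex hull (V1_face (A_mat (1, 1, 1)) \<union> V1_face (A_mat (2, b, 1 / b)))"
    using V1_face_segment[of b s e] by blast+
qed

end
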